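(* Let $(X,\mathcal A,\mu,T)$ be a conservative ergodic infinite measure preserving system (as in the context) satisfying properties (P1) and (P2) stated in the context, and assume that $T$ admits a measurable law of large numbers. If a probability preserving system $(Y,\mathcal Y,\nu,S)$ is disjoint from the Poisson suspension $(X^*,\mathcal A^*,\mu^*,T_* )$, then it is disjoint from $(X^*,\mathcal A^*,(\alpha\mu)^*,T_* )$ for any $\alpha>0$.
   Context: Setting. $X$ is a complete separable metric space with Borel $\sigma$-algebra $\mathcal A$; $\mu$ is a measure on $(X,\mathcal A)$ that is boundedly finite (finite on bounded Borel sets), with $\mu(X)=\infty$; $T:X\to X$ is invertible and preserves $\mu$, and $(X,\mathcal A,\mu,T)$ is conservative and ergodic. Poisson suspension. $X^*$ is the set of boundedly finite simple counting measures $\xi=\sum_{i\in I}\delta_{x_i}$ ($I$ at most countable, $x_i$ distinct), and $\mathcal A^*$ is the $\sigma$-algebra generated by the maps $\xi\mapsto\xi(A)$, $A$ bounded Borel. For $\alpha>0$, $(\alpha\mu)^*$ is the distribution on $X^*$ of the Poisson point process of intensity $\alpha\mu$: under it, for mutually disjoint $A_1,\dots,A_k$ of finite measure, the variables $\xi(A_1),\dots,\xi(A_k)$ are independent and Poisson distributed with parameters $\alpha\mu(A_1),\dots,\alpha\mu(A_k)$. The transformation $T_*\xi=\xi\circ T^{-1}$ preserves $(\alpha\mu)^*$. Two probability preserving systems are disjoint if their only joining (probability measure on the product space, invariant under the product transformation, with the given marginals) is the product measure. Measurable law of large numbers. $T$ admits one if there is a measurable function $L:\{0,1\}^{\mathbb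 N}\to[0,\infty]$ such that for all $B\in\mathcal A$, for $\mu$-a.e. $x\in X$, $L(\mathbf 1_B(x),\mathbf 1_B(Tx),\ldots)=\mu(B)$. Properties (P1), (P2). For $n\ge1$, let $\mathscr P_n$ be the set of partitions of $\{1,\dots,n\}$. For $\pi\in\mathscr P_n$ and $\kappa=(k_i)_{1\le i\le n}$ a family of integers, $m_\pi^\kappa$ is the measure on $X^n$ with $m_\pi^\kappa(A_1\times\cdots\times A_n)=\prod_{P\in\pi}\mu\left(\bigcap_{i\in P}T^{-k_i}A_i\right)$. $\kappa$ is $\pi$-compatible if $k_i=0$ whenever $i$ is the smallest element of an atom of $\pi$. (P1): for each $n\ge1$, the product system $(X^n,\mathcal A^{\otimes n},\mu^{\otimes n},T^{\times n})$ is ergodic. (P2): for each $n\ge1$, if $\sigma$ is a boundedly finite, $T^{\times n}$-invariant measure on $X^n$ whose marginals are absolutely continuous with respect to $\mu$, then $\sigma$ is conservative and its ergodic components are all (up to positive multiplicative constants) of the form $m_\pi^\kappa$ for some $\pi\in\mathscr P_n$ and some $\pi$-compatible family $\kappa$. *)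

theory Defs
  imports "HOL-Probability.Probability"
begin

section \<open>Measure preserving systems\<close>

text \<open>
  The preimage is taken inside \<^term>\<open>space M\<close>, so invariance also makes sense for a map which leaves
  the space on an exceptional set. By invariance of the whole space that set is null as soon as
  \<^term>\<open>M\<close> is finite. This matters for the Poisson suspension below.
\<close>

definition invariant_measure :: "'a measure \<Rightarrow> ('a \<Rightarrow> 'a) \<Rightarrow> bool" where
  "invariant_measure M f \<longleftrightarrow>
     (\<forall>A\<in>sets M. f -` A \<inter> space M \<in> sets M \<and> emeasure M (f -` A \<inter> space M) = emeasure M A)"

definition conservative :: "'a measure \<Rightarrow> ('a \<Rightarrow> 'a) \<Rightarrow> bool" where
  "conservative M f \<longleftrightarrow>
     (\<forall>W\<in>sets M. disjoint_family (\<lambda>k. (f ^^ k) -` W \<inter> space M) \<longrightarrow> emeasure M W = 0)"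

definition ergodic :: "'a measure \<Rightarrow> ('a \<Rightarrow> 'a) \<Rightarrow> bool" where
  "ergodic M f \<longleftrightarrow>
     (\<forall>A\<in>sets M. f -` A \<inter> space M = A \<longrightarrow> emeasure M A = 0 \<or> emeasure M (space M - A) = 0)"

definition boundedly_finite :: "'x::metric_space measure \<Rightarrow> bool" where
  "boundedly_finite m \<longleftrightarrow> (\<forall>A\<in>sets m. bounded A \<longrightarrow> emeasure m A < \<infinity>)"

text \<open>The underlying complete separable metric space is the whole type.\<close>

definition infinite_invertible_system :: "'x::polish_space measure \<Rightarrow> ('x \<Rightarrow> 'x) \<Rightarrow> bool" where
  "infinite_invertible_system M T \<longleftrightarrow>
     sets M = sets borel \<and> boundedly_finite M \<and> emeasure M (space M) = \<infinity> \<and>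
     bij T \<and> T \<in> M \<rightarrow>\<^sub>M M \<and> inv T \<in> M \<rightarrow>\<^sub>M M \<and> invariant_measure M T"

definition probability_preserving_system :: "'y measure \<Rightarrow> ('y \<Rightarrow> 'y) \<Rightarrow> bool" where
  "probability_preserving_system N S \<longleftrightarrow>
     prob_space N \<and> S \<in> N \<rightarrow>\<^sub>M N \<and> invariant_measure N S"

section \<open>Joinings and disjointness\<close>

definition joining ::
  "'a measure \<Rightarrow> ('a \<Rightarrow> 'a) \<Rightarrow> 'b measure \<Rightarrow> ('b \<Rightarrow> 'b) \<Rightarrow> ('a \<times> 'b) measure \<Rightarrow> bool" where
  "joining M f N g J \<longleftrightarrow>
     sets J = sets (M \<Otimes>\<^sub>M N) \<and> prob_space J \<and> invariant_measure J (map_prod f g) \<and>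
     distr J M fst = M \<and> distr J N snd = N"

definition disjoint_systems ::
  "'a measure \<Rightarrow> ('a \<Rightarrow> 'a) \<Rightarrow> 'b measure \<Rightarrow> ('b \<Rightarrow> 'b) \<Rightarrow> bool" where
  "disjoint_systems M f N g \<longleftrightarrow> (\<forall>J. joining M f N g J \<longrightarrow> J = M \<Otimes>\<^sub>M N)"

section \<open>The Poisson suspension\<close>

text \<open>The smallest \<open>\<sigma>\<close>-algebra on the set \<open>\<Omega>\<close> of measures making \<open>m \<mapsto> m(A)\<close> measurable for all \<open>A \<in> \<G>\<close>.\<close>

definition evaluation_algebra :: "'a measure set \<Rightarrow> 'a set set \<Rightarrow> 'a measure measure" where
  "evaluation_algebra \<Omega> \<G> =
     sigma \<Omega> {(\<lambda>m. emeasure m A) -` B \<inter> \<Omega> | A B. A \<in> \<G> \<and> B \<in> sets borel}"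

definition simple_counting_measures :: "'x::polish_space measure set" where
  "simple_counting_measures =
     {\<xi>. sets \<xi> = sets borel \<and> boundedly_finite \<xi> \<and>
         (\<exists>I. countable I \<and>
            (\<forall>A\<in>sets borel. emeasure \<xi> A = (\<integral>\<^sup>+x. emeasure (return borel x) A \<partial>count_space I)))}"

definition configuration_space :: "'x::polish_space measure measure" where
  "configuration_space =
     evaluation_algebra simple_counting_measures {A. A \<in> sets borel \<and> bounded A}"

text \<open>
  \<open>P\<close> is the distribution of the Poisson point process with intensity \<open>m\<close>. These conditions
  determine \<open>P\<close> uniquely.
\<close>

definition poisson_law :: "'x::polish_space measure \<Rightarrow> 'x measure measure \<Rightarrow> bool" where
  "poisson_law m P \<longleftrightarrow>
     sets P = sets configuration_space \<and> prob_space P \<and>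
     (\<forall>(k::nat) A. (\<forall>i<k. A i \<in> sets m \<and> emeasure m (A i) < \<infinity>) \<and> disjoint_family_on A {..<k} \<longrightarrow>
        prob_space.indep_vars P (\<lambda>_. borel) (\<lambda>i \<xi>. emeasure \<xi> (A i)) {..<k} \<and>
        (\<forall>i<k. \<forall>j::nat. measure P {\<xi>\<in>space P. emeasure \<xi> (A i) = of_nat j} =
           exp (- measure m (A i)) * measure m (A i) ^ j / fact j))"

text \<open>
  The image of a configuration need not be boundedly finite, as \<open>T\<close> need not preserve boundedness.
  So this maps the configuration space to itself only almost everywhere with respect to the Poisson
  laws of invariant intensities.
\<close>

definition suspension_map :: "('x::polish_space \<Rightarrow> 'x) \<Rightarrow> 'x measure \<Rightarrow> 'x measure" where
  "suspension_map T \<xi> = distr \<xi> borel T"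

section \<open>Measurable law of large numbers\<close>

text \<open>Sequences in \<open>{0,1}\<close> are functions from \<^typ>\<open>nat\<close> to \<^typ>\<open>bool\<close>.\<close>

definition measurable_law_of_large_numbers :: "'x measure \<Rightarrow> ('x \<Rightarrow> 'x) \<Rightarrow> bool" where
  "measurable_law_of_large_numbers M T \<longleftrightarrow>
     (\<exists>L :: (nat \<Rightarrow> bool) \<Rightarrow> ennreal.
        L \<in> (\<Pi>\<^sub>M i\<in>UNIV. count_space UNIV) \<rightarrow>\<^sub>M borel \<and>
        (\<forall>B\<in>sets M. AE x in M. L (\<lambda>n. (T ^^ n) x \<in> B) = emeasure M B))"

section \<open>Finite powers and the properties (P1) and (P2)\<close>

text \<open>Points of \<open>X\<^sup>n\<close> are the extensional functions on \<open>{1..n}\<close>.\<close>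

definition power_map :: "nat \<Rightarrow> ('x \<Rightarrow> 'x) \<Rightarrow> (nat \<Rightarrow> 'x) \<Rightarrow> (nat \<Rightarrow> 'x)" where
  "power_map n T x = (\<lambda>i\<in>{1..n}. T (x i))"

definition power_borel :: "nat \<Rightarrow> (nat \<Rightarrow> 'x::polish_space) measure" where
  "power_borel n = (\<Pi>\<^sub>M i\<in>{1..n}. borel)"

definition power_bounded :: "nat \<Rightarrow> (nat \<Rightarrow> 'x::polish_space) set \<Rightarrow> bool" where
  "power_bounded n A \<longleftrightarrow> (\<forall>i\<in>{1..n}. bounded ((\<lambda>x. x i) ` A))"

definition power_boundedly_finite :: "nat \<Rightarrow> (nat \<Rightarrow> 'x::polish_space) measure set" where
  "power_boundedly_finite n =
     {m. sets m = sets (power_borel n) \<and>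
         (\<forall>A\<in>sets m. power_bounded n A \<longrightarrow> emeasure m A < \<infinity>)}"

definition int_iterate :: "('x \<Rightarrow> 'x) \<Rightarrow> int \<Rightarrow> 'x \<Rightarrow> 'x" where
  "int_iterate T k = (if 0 \<le> k then T ^^ nat k else inv T ^^ nat (- k))"

text \<open>\<open>m\<close> is the measure \<open>m\<^sub>\<pi>\<^sup>\<kappa>\<close>, which is determined by its values on rectangles.\<close>

definition is_m_pi_kappa ::
  "'x::polish_space measure \<Rightarrow> ('x \<Rightarrow> 'x) \<Rightarrow> nat \<Rightarrow> nat set set \<Rightarrow> (nat \<Rightarrow> int) \<Rightarrow>
   (nat \<Rightarrow> 'x) measure \<Rightarrow> bool" where
  "is_m_pi_kappa M T n \<pi> \<kappa> m \<longleftrightarrow>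
     sets m = sets (power_borel n) \<and>
     (\<forall>A. (\<forall>i\<in>{1..n}. A i \<in> sets M) \<longrightarrow>
        emeasure m (Pi\<^sub>E {1..n} A) = (\<Prod>P\<in>\<pi>. emeasure M (\<Inter>i\<in>P. int_iterate T (\<kappa> i) -` A i)))"

definition compatible :: "nat set set \<Rightarrow> (nat \<Rightarrow> int) \<Rightarrow> bool" where
  "compatible \<pi> \<kappa> \<longleftrightarrow> (\<forall>P\<in>\<pi>. \<kappa> (Min P) = 0)"

text \<open>
  \<open>\<rho>\<close> is an ergodic decomposition of the boundedly finite measure \<open>\<sigma>\<close> on \<open>X\<^sup>n\<close>: the ergodic
  components are \<open>\<rho>\<close>-almost all points \<open>m\<close>, and \<open>\<sigma> = \<integral> m d\<rho>(m)\<close>. As \<open>\<sigma>\<close> may be infinite, components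
  are only determined up to positive factors and \<open>\<rho>\<close> is only \<open>\<sigma>\<close>-finite; the zero measure is
  no ergodic component, and for \<open>\<sigma> = 0\<close> the decomposition is \<open>\<rho> = 0\<close>.
\<close>

definition ergodic_decomposition ::
  "nat \<Rightarrow> ((nat \<Rightarrow> 'x::polish_space) \<Rightarrow> (nat \<Rightarrow> 'x)) \<Rightarrow> (nat \<Rightarrow> 'x) measure \<Rightarrow>
   (nat \<Rightarrow> 'x) measure measure \<Rightarrow> bool" where
  "ergodic_decomposition n f \<sigma> \<rho> \<longleftrightarrow>
     sets \<rho> = sets (evaluation_algebra (power_boundedly_finite n)
                      {A. A \<in> sets (power_borel n) \<and> power_bounded n A}) \<and>
     sigma_finite_measure \<rho> \<and>
     (AE m in \<rho>. invariant_measure m f \<and> ergodic m f \<and> emeasure m (space m) \<noteq> 0) \<and>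
     (\<forall>A\<in>sets \<sigma>. emeasure \<sigma> A = (\<integral>\<^sup>+m. emeasure m A \<partial>\<rho>))"

definition property_P1 :: "'x::polish_space measure \<Rightarrow> ('x \<Rightarrow> 'x) \<Rightarrow> bool" where
  "property_P1 M T \<longleftrightarrow> (\<forall>n\<ge>1. ergodic (\<Pi>\<^sub>M i\<in>{1..n}. M) (power_map n T))"

text \<open>
  Ergodic decompositions are essentially unique up to rescaling the components, so quantifying
  existentially over \<open>\<rho>\<close> is a statement about the ergodic components of \<open>\<sigma>\<close>.
\<close>

definition property_P2 :: "'x::polish_space measure \<Rightarrow> ('x \<Rightarrow> 'x) \<Rightarrow> bool" where
  "property_P2 M T \<longleftrightarrow>
     (\<forall>n\<ge>1. \<forall>\<sigma>\<in>power_boundedly_finite n.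
        invariant_measure \<sigma> (power_map n T) \<and>
        (\<forall>i\<in>{1..n}. absolutely_continuous M (distr \<sigma> M (\<lambda>x. x i))) \<longrightarrow>
        conservative \<sigma> (power_map n T) \<and>
        (\<exists>\<rho>. ergodic_decomposition n (power_map n T) \<sigma> \<rho> \<and>
           (AE m in \<rho>. \<exists>c::real. \<exists>\<pi> \<kappa> m'. c > 0 \<and> partition_on {1..n} \<pi> \<and> compatible \<pi> \<kappa> \<and>
              is_m_pi_kappa M T n \<pi> \<kappa> m' \<and> m = scale_measure (ennreal c) m')))"

end

theory Submission
  imports Defs "HOL-Complex_Analysis.Conformal_Mappings"
begin

text \<open>
  A joining of \<open>N\<close> with the suspension of intensity \<open>\<alpha>\<mu>\<close> can be turned into joinings of \<open>N\<close> with the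
  suspension of intensity \<open>\<mu>\<close>. Let \<open>(y, \<xi>)\<close> be distributed according to the given joining \<open>J\<close>, and let
  \<open>0 < p < 1\<close> with \<open>p\<alpha> < 1\<close>. Keep each point of \<open>\<xi>\<close> independently with probability \<open>p\<close>; this leaves a
  Poisson process of intensity \<open>p\<alpha>\<mu>\<close>. Then add an independent Poisson process of intensity
  \<open>(1 - p\<alpha>)\<mu>\<close>, itself a thinning of the process of intensity \<open>\<mu>\<close>. The resulting configuration \<open>\<zeta>\<close> is
  Poisson of intensity \<open>\<mu>\<close>. As both operations commute in law with the suspension map, \<open>(y, \<zeta>)\<close> is
  distributed according to a joining, and by disjointness \<open>\<zeta>\<close> is independent of \<open>y\<close>.

  Given \<open>(y, \<xi>)\<close>, the configuration \<open>\<zeta>\<close> misses \<open>A\<close> with probability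
  \<open>(1 - p)\<^bsup>\<xi>(A)\<^esup> exp (- (1 - p\<alpha>) \<mu>(A))\<close>. So the independence says that, for each measurable set \<open>B\<close> of
  values of \<open>y\<close>, the power series \<open>\<Sum>\<^sub>j J(B \<times> {\<xi>(A) = j}) z\<^sup>j\<close> equals \<open>N(B) exp (- (1 - z) \<alpha>\<mu>(A))\<close> at
  all points \<open>z = 1 - p\<close> of an interval, hence on the whole unit disc. At \<open>z = 0\<close> this is
  \<open>J(B \<times> {\<xi>(A) = 0}) = N(B) exp (- \<alpha>\<mu>(A))\<close>, the value of the product measure.

  Laws on configurations are handled by their void events \<open>{\<xi>(A) = 0}\<close> only. Since configurations are
  simple, these events generate the \<open>\<sigma>\<close>-algebra and are closed under intersection
  (\<open>void_rectangles_determine\<close>), and they suffice to check measurability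
  (\<open>measurable_configurationI\<close>) and invariance (\<open>invariant_suspensionI\<close>). They also turn thinning
  and superposition into a substitution in a generating function and a product
  (\<open>thin_and_superpose\<close>).

  To thin measurably, the points of a configuration need coins of their own. Each point is isolated
  from the others by some member of a countable base of the topology, and the first such member
  names its coin.
\<close>

section \<open>Configurations and their atoms\<close>

definition atoms :: "'x measure \<Rightarrow> 'x set" where
  "atoms \<xi> = {x. emeasure \<xi> {x} \<noteq> 0}"

definition locally_finite :: "'x::polish_space set \<Rightarrow> bool" where
  "locally_finite I \<longleftrightarrow> (\<forall>A\<in>sets borel. bounded A \<longrightarrow> finite (I \<inter> A))"

definition configuration :: "'x::polish_space set \<Rightarrow> 'x measure" where
  "configuration I = distr (count_space I) borel (\<lambda>x. x)"

lemma locally_finite_subset: "locally_finite I \<Longrightarrow> J \<subseteq> I \<Longrightarrow> locally_finite J"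
  unfolding locally_finite_def by (meson Int_mono finite_subset order_refl)

lemma locally_finite_Un: "locally_finite I \<Longrightarrow> locally_finite J \<Longrightarrow> locally_finite (I \<union> J)"
  unfolding locally_finite_def by (auto simp: Int_Un_distrib2)

lemma balls_exhaust: "(\<Union>n. ball (x::'x::metric_space) (real n)) = UNIV"
proof -
  have "\<exists>n. dist x y < real n" for y by (rule reals_Archimedean2)
  then show ?thesis by auto
qed

lemma locally_finite_countable:
  assumes "locally_finite (I :: 'x::polish_space set)" shows "countable I"
proof -
  have "finite (I \<inter> ball undefined (real n))" for n
    using assms by (auto simp: locally_finite_def)
  then have "countable (\<Union>n. I \<inter> ball undefined (real n))"
    by (intro countable_UN[OF countableI_type] countable_finite)
  also have "(\<Union>n. I \<inter> ball undefined (real n)) = I"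
    using balls_exhaust[of undefined] by blast
  finally show ?thesis .
qed

lemma sets_configuration [simp]: "sets (configuration I) = sets borel"
  by (simp add: configuration_def)

lemma emeasure_configuration:
  assumes "A \<in> sets borel"
  shows "emeasure (configuration I) A = emeasure (count_space UNIV) (I \<inter> A)"
proof -
  have "emeasure (configuration I) A = emeasure (count_space I) (A \<inter> I)"
    using assms unfolding configuration_def by (subst emeasure_distr) auto
  also have "\<dots> = emeasure (count_space UNIV) (I \<inter> A)"
    by (simp add: emeasure_count_space Int_commute)
  finally show ?thesis .
qed

lemma atoms_configuration [simp]: "atoms (configuration I) = I"
proof -
  have "emeasure (count_space UNIV) (I \<inter> {x}) \<noteq> 0 \<longleftrightarrow> x \<in> I" for x
    by (auto simp: emeasure_count_space)
  then show ?thesis by (auto simp: atoms_def emeasure_configuration)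
qed

lemma nn_integral_diracs:
  assumes "A \<in> sets borel"
  shows "(\<integral>\<^sup>+x. emeasure (return borel x) A \<partial>count_space I) = emeasure (count_space UNIV) (I \<inter> A)"
proof -
  have "(\<integral>\<^sup>+x. emeasure (return borel x) A \<partial>count_space I) = (\<integral>\<^sup>+x. indicator (A \<inter> I) x \<partial>count_space I)"
    using assms by (intro nn_integral_cong) (auto simp: indicator_def)
  also have "\<dots> = emeasure (count_space I) (A \<inter> I)"
    by (rule nn_integral_indicator) auto
  also have "\<dots> = emeasure (count_space UNIV) (I \<inter> A)"
    by (simp add: emeasure_count_space Int_commute)
  finally show ?thesis .
qed

lemma simple_counting_measuresI:
  assumes sets: "sets \<xi> = sets borel" and lf: "locally_finite I"
    and eq: "\<And>A. A \<in> sets borel \<Longrightarrow> emeasure \<xi> A = emeasure (count_space UNIV) (I \<inter> A)"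
  shows "\<xi> \<in> simple_counting_measures"
proof -
  have "boundedly_finite \<xi>"
    using lf unfolding boundedly_finite_def locally_finite_def
    by (auto simp: sets eq emeasure_count_space of_nat_less_top)
  moreover have "countable I" by (rule locally_finite_countable[OF lf])
  moreover have "\<forall>A\<in>sets borel. emeasure \<xi> A = (\<integral>\<^sup>+x. emeasure (return borel x) A \<partial>count_space I)"
    using eq nn_integral_diracs by metis
  ultimately show ?thesis using sets unfolding simple_counting_measures_def by blast
qed

lemma configuration_in: "locally_finite I \<Longrightarrow> configuration I \<in> simple_counting_measures"
  by (rule simple_counting_measuresI) (auto simp: emeasure_configuration)

text \<open>
A configuration is determined by its atoms: it counts them. Through this lemma thinning and
superposition become operations on sets of atoms.
\<close>

lemma simple_countingD:
  assumes "\<xi> \<in> simple_counting_measures"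
  shows sets_simple_counting: "sets \<xi> = sets borel"
    and emeasure_atoms:
      "\<And>A. A \<in> sets borel \<Longrightarrow> emeasure \<xi> A = emeasure (count_space UNIV) (atoms \<xi> \<inter> A)"
    and locally_finite_atoms: "locally_finite (atoms \<xi>)"
proof -
  obtain I where I: "countable I"
    "\<And>A. A \<in> sets borel \<Longrightarrow> emeasure \<xi> A = (\<integral>\<^sup>+x. emeasure (return borel x) A \<partial>count_space I)"
    and s: "sets \<xi> = sets borel" and bf: "boundedly_finite \<xi>"
    using assms unfolding simple_counting_measures_def by blast
  have e: "emeasure \<xi> A = emeasure (count_space UNIV) (I \<inter> A)" if "A \<in> sets borel" for A
    using I(2)[OF that] nn_integral_diracs[OF that] by simp
  have "atoms \<xi> = atoms (configuration I)"
    by (simp add: atoms_def e emeasure_configuration)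
  then have a: "atoms \<xi> = I" by simp
  show "sets \<xi> = sets borel" by (rule s)
  show *: "\<And>A. A \<in> sets borel \<Longrightarrow> emeasure \<xi> A = emeasure (count_space UNIV) (atoms \<xi> \<inter> A)"
    using e a by simp
  have "finite (atoms \<xi> \<inter> A)" if "A \<in> sets borel" "bounded A" for A
  proof -
    have "emeasure \<xi> A < \<infinity>" using bf that s by (auto simp: boundedly_finite_def)
    then show ?thesis using *[OF that(1)] by (auto simp: emeasure_count_space split: if_splits)
  qed
  then show "locally_finite (atoms \<xi>)" by (simp add: locally_finite_def)
qed

lemma void_iff:
  assumes "\<xi> \<in> simple_counting_measures" "A \<in> sets borel"
  shows "emeasure \<xi> A = 0 \<longleftrightarrow> atoms \<xi> \<inter> A = {}"
  using assms by (simp add: emeasure_atoms emeasure_count_space_eq_0)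

section \<open>An isolating sequence of open sets\<close>

text \<open>
An enumeration of a countable base of the topology. Its members serve as names for the points of a
configuration, since some member meets the configuration in that point only.
\<close>

definition isolating_open :: "nat \<Rightarrow> 'x::polish_space set" where
  "isolating_open = (SOME U. (\<forall>i. open (U i)) \<and> (\<forall>x G. open G \<and> x \<in> G \<longrightarrow> (\<exists>i. x \<in> U i \<and> U i \<subseteq> G)))"

lemma isolating_open:
  fixes G :: "'a::polish_space set"
  shows open_isolating: "open (isolating_open i :: 'a set)"
    and isolatingE: "open G \<Longrightarrow> x \<in> G \<Longrightarrow> \<exists>i. x \<in> isolating_open i \<and> isolating_open i \<subseteq> G"
proof -
  obtain B :: "'a set set" where B: "countable B" "topological_basis B"
    using ex_countable_basis by blast
  have ne: "B \<noteq> {}" using topological_basisE[OF B(2) open_UNIV UNIV_I] by blast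
  define U where "U = from_nat_into B"
  have "range U = B" unfolding U_def using ne B(1) by (rule range_from_nat_into)
  then have "\<forall>i. open (U i)" using topological_basis_open[OF B(2)] by auto
  moreover have "\<forall>x G. open G \<and> x \<in> G \<longrightarrow> (\<exists>i. x \<in> U i \<and> U i \<subseteq> G)"
    using topological_basisE[OF B(2)] \<open>range U = B\<close> by (metis imageE)
  ultimately have "\<exists>U::nat \<Rightarrow> 'a set. (\<forall>i. open (U i)) \<and> (\<forall>x G. open G \<and> x \<in> G \<longrightarrow> (\<exists>i. x \<in> U i \<and> U i \<subseteq> G))"
    by blast
  from someI_ex[OF this] have *: "(\<forall>i. open (isolating_open i :: 'a set)) \<and>
      (\<forall>x G. open G \<and> (x::'a) \<in> G \<longrightarrow> (\<exists>i. x \<in> isolating_open i \<and> isolating_open i \<subseteq> G))"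
    unfolding isolating_open_def .
  then show "open (isolating_open i :: 'a set)" by blast
  show "open G \<Longrightarrow> x \<in> G \<Longrightarrow> \<exists>i. x \<in> isolating_open i \<and> isolating_open i \<subseteq> G"
    using * by blast
qed

lemma borel_isolating [measurable, simp]: "isolating_open i \<in> sets borel"
  by (simp add: open_isolating)

section \<open>Void events determine laws on configurations\<close>

lemma space_configuration_space [simp]: "space configuration_space = simple_counting_measures"
  by (simp add: configuration_space_def evaluation_algebra_def space_measure_of_conv)

lemma measurable_count_bounded:
  assumes "A \<in> sets borel" "bounded A"
  shows "(\<lambda>\<xi>. emeasure \<xi> A) \<in> borel_measurable configuration_space"
proof (rule measurableI)
  fix B :: "ennreal set" assume "B \<in> sets borel"
  then show "(\<lambda>\<xi>. emeasure \<xi> A) -` B \<inter> space configuration_space \<in> sets configuration_space"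
    using assms unfolding configuration_space_def evaluation_algebra_def
    by (subst sets_measure_of) (auto simp: space_measure_of_conv intro!: sigma_sets.Basic)
qed simp

lemma measurable_count [measurable]:
  assumes A: "A \<in> sets borel"
  shows "(\<lambda>\<xi>. emeasure \<xi> A) \<in> borel_measurable configuration_space"
proof -
  have "(\<lambda>\<xi>. SUP n. emeasure \<xi> (A \<inter> ball undefined (real n))) \<in> borel_measurable configuration_space"
    using A by (intro borel_measurable_SUP measurable_count_bounded) (auto intro: bounded_subset[OF bounded_ball])
  moreover have "(SUP n. emeasure \<xi> (A \<inter> ball undefined (real n))) = emeasure \<xi> A"
    if "\<xi> \<in> simple_counting_measures" for \<xi>
  proof -
    have "(SUP n. emeasure \<xi> (A \<inter> ball undefined (real n))) = emeasure \<xi> (\<Union>n. A \<inter> ball undefined (real n))"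
      using A that by (intro SUP_emeasure_incseq) (auto simp: incseq_def sets_simple_counting)
    also have "(\<Union>n. A \<inter> ball undefined (real n)) = A"
      using balls_exhaust[of undefined] by blast
    finally show ?thesis .
  qed
  ultimately show ?thesis by (subst measurable_cong[where g="\<lambda>\<xi>. SUP n. emeasure \<xi> (A \<inter> ball undefined (real n))"]) auto
qed

definition void :: "'x::polish_space set \<Rightarrow> 'x measure set" where
  "void A = {\<xi>\<in>simple_counting_measures. emeasure \<xi> A = 0}"

lemma sets_void [measurable]: "A \<in> sets borel \<Longrightarrow> void A \<in> sets configuration_space"
proof -
  assume [measurable]: "A \<in> sets borel"
  have "{\<xi>\<in>space configuration_space. emeasure \<xi> A = 0} \<in> sets configuration_space" by measurable
  then show ?thesis by (simp add: void_def)
qed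

lemma void_Int:
  assumes "A \<in> sets borel" "B \<in> sets borel"
  shows "void A \<inter> void B = void (A \<union> B)"
  using assms by (auto simp: void_def void_iff)

lemma void_empty [simp]: "void {} = simple_counting_measures"
  by (auto simp: void_def)

text \<open>
A set has more than \<open>k\<close> points iff one of its points can be separated by a basic open set from
\<open>k\<close> others. Iterated, this expresses counts through countably many statements that some Borel
set is hit or missed.
\<close>

lemma Suc_le_count_iff:
  fixes K :: "'x::polish_space set"
  shows "of_nat (Suc k) \<le> emeasure (count_space UNIV) K \<longleftrightarrow>
    (\<exists>i. K \<inter> isolating_open i \<noteq> {} \<and> of_nat k \<le> emeasure (count_space UNIV) (K - isolating_open i))"
proof
  assume *: "of_nat (Suc k) \<le> emeasure (count_space UNIV) K"
  have "\<exists>G\<subseteq>K. finite G \<and> card G = Suc k"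
  proof (cases "finite K")
    case True
    then have "Suc k \<le> card K" using * by (simp add: emeasure_count_space del: of_nat_Suc)
    then show ?thesis using obtain_subset_with_card_n by (metis True finite_subset)
  next
    case False
    then show ?thesis using infinite_arbitrarily_large by blast
  qed
  then obtain G where G: "G \<subseteq> K" "finite G" "card G = Suc k" by blast
  then obtain x where x: "x \<in> G" by fastforce
  have "open (- (G - {x}))" by (rule open_Compl, rule finite_imp_closed) (use G(2) in auto)
  then obtain i where i: "x \<in> isolating_open i" "isolating_open i \<subseteq> - (G - {x})"
    using isolatingE[of "- (G - {x})" x] by auto
  have "of_nat k = emeasure (count_space UNIV) (G - {x})"
    using G x by (simp add: emeasure_count_space)
  also have "\<dots> \<le> emeasure (count_space UNIV) (K - isolating_open i)"
    using i G(1) by (intro emeasure_mono) auto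
  finally show "\<exists>i. K \<inter> isolating_open i \<noteq> {} \<and> of_nat k \<le> emeasure (count_space UNIV) (K - isolating_open i)"
    using i x G by blast
next
  assume "\<exists>i. K \<inter> isolating_open i \<noteq> {} \<and> of_nat k \<le> emeasure (count_space UNIV) (K - isolating_open i)"
  then obtain i where i: "K \<inter> isolating_open i \<noteq> {}" "of_nat k \<le> emeasure (count_space UNIV) (K - isolating_open i)"
    by blast
  have "1 \<le> emeasure (count_space UNIV) (K \<inter> isolating_open i)"
    using i(1) by (auto simp: emeasure_count_space Suc_le_eq card_gt_0_iff simp del: of_nat_Suc)
  then have "of_nat (Suc k) \<le> emeasure (count_space UNIV) (K \<inter> isolating_open i) + emeasure (count_space UNIV) (K - isolating_open i)"
    using i(2) by (simp add: add_mono)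
  also have "\<dots> = emeasure (count_space UNIV) ((K \<inter> isolating_open i) \<union> (K - isolating_open i))"
    by (rule plus_emeasure) auto
  also have "(K \<inter> isolating_open i) \<union> (K - isolating_open i) = K" by blast
  finally show "of_nat (Suc k) \<le> emeasure (count_space UNIV) K" .
qed

text \<open>
As configurations are simple, each count \<open>\<xi>(A)\<close> is a function of the countably many void
indicators supplied by the previous lemma, so void events suffice to check measurability.
\<close>

lemma measurable_configurationI:
  fixes f :: "'w \<Rightarrow> 'x::polish_space measure"
  assumes f: "\<And>w. w \<in> space W \<Longrightarrow> f w \<in> simple_counting_measures"
    and void: "\<And>A. A \<in> sets borel \<Longrightarrow> bounded A \<Longrightarrow> {w\<in>space W. emeasure (f w) A = 0} \<in> sets W"
  shows "f \<in> W \<rightarrow>\<^sub>M configuration_space"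
proof -
  have ge: "{w\<in>space W. of_nat k \<le> emeasure (f w) A} \<in> sets W" if "A \<in> sets borel" "bounded A" for k A
    using that
  proof (induction k arbitrary: A)
    case (Suc k)
    have "{w\<in>space W. of_nat (Suc k) \<le> emeasure (f w) A} =
      (\<Union>i. (space W - {w\<in>space W. emeasure (f w) (A \<inter> isolating_open i) = 0}) \<inter>
        {w\<in>space W. of_nat k \<le> emeasure (f w) (A - isolating_open i)})"
    proof -
      have "of_nat (Suc k) \<le> emeasure (f w) A \<longleftrightarrow>
        (\<exists>i. emeasure (f w) (A \<inter> isolating_open i) \<noteq> 0 \<and> of_nat k \<le> emeasure (f w) (A - isolating_open i))"
        if "w \<in> space W" for w
        using f[OF that] Suc.prems(1) Suc_le_count_iff[of k "atoms (f w) \<inter> A"]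
        by (simp add: emeasure_atoms emeasure_count_space_eq_0 Int_assoc Diff_Int_distrib2 Int_Diff del: of_nat_Suc)
      then show ?thesis by (auto simp del: of_nat_Suc)
    qed
    also have "\<dots> \<in> sets W"
    proof -
      have "bounded (A \<inter> isolating_open i)" "bounded (A - isolating_open i)" for i
        using Suc.prems(2) by (auto intro: bounded_subset)
      then have "{w\<in>space W. emeasure (f w) (A \<inter> isolating_open i) = 0} \<in> sets W"
        "{w\<in>space W. of_nat k \<le> emeasure (f w) (A - isolating_open i)} \<in> sets W" for i
        using Suc by (auto intro!: void)
      then show ?thesis by (intro sets.countable_UN' sets.Int sets.Diff sets.top) auto
    qed
    finally show ?case .
  qed simp
  have meas: "(\<lambda>w. emeasure (f w) A) \<in> borel_measurable W" if A: "A \<in> sets borel" "bounded A" for A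
  proof -
    have fin: "emeasure (f w) A \<in> range of_nat" if "w \<in> space W" for w
      using f[OF that] A locally_finite_atoms[OF f[OF that]]
      by (auto simp: emeasure_atoms emeasure_count_space locally_finite_def)
    show ?thesis
    proof (rule borel_measurableI_ge)
      fix a :: ennreal
      have "{w\<in>space W. a \<le> emeasure (f w) A} =
        (\<Union>k\<in>{k. a \<le> of_nat k}. {w\<in>space W. of_nat k \<le> emeasure (f w) A})"
        using fin by (fastforce intro: order_trans)
      also have "\<dots> \<in> sets W" using ge[OF A] by (intro sets.countable_UN') auto
      finally show "{w\<in>space W. a \<le> emeasure (f w) A} \<in> sets W" .
    qed
  qed
  show ?thesis
    unfolding configuration_space_def evaluation_algebra_def
  proof (rule measurable_measure_of)
    fix y assume "y \<in> {(\<lambda>m. emeasure m A) -` B \<inter> (simple_counting_measures :: 'x measure set) |A B.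
             A \<in> {A \<in> sets borel. bounded A} \<and> B \<in> sets (borel :: ennreal measure)}"
    then obtain A B where y: "y = (\<lambda>m. emeasure m A) -` B \<inter> simple_counting_measures"
      and A: "A \<in> sets borel" "bounded A" and B: "B \<in> sets (borel :: ennreal measure)" by blast
    have "f -` y \<inter> space W = (\<lambda>w. emeasure (f w) A) -` B \<inter> space W" using f y by auto
    also have "\<dots> \<in> sets W" using measurable_sets[OF meas[OF A] B] .
    finally show "f -` y \<inter> space W \<in> sets W" .
  qed (use f in auto)
qed

lemma sets_configuration_space_void:
  "sets configuration_space =
     sigma_sets simple_counting_measures {void A | A. A \<in> sets (borel::'x::polish_space measure) \<and> bounded A}"
    (is "_ = sigma_sets ?\<Omega> ?V")
proof
  have V: "?V \<subseteq> Pow ?\<Omega>" by (auto simp: void_def)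
  show "sigma_sets ?\<Omega> ?V \<subseteq> sets configuration_space"
    using sets.sigma_sets_subset[of ?V "configuration_space :: 'x measure measure"] sets_void by auto
  have "(\<lambda>\<xi>. \<xi>) \<in> sigma ?\<Omega> ?V \<rightarrow>\<^sub>M configuration_space"
  proof (rule measurable_configurationI)
    fix A :: "'x set" assume "A \<in> sets borel" "bounded A"
    then show "{\<xi>\<in>space (sigma ?\<Omega> ?V). emeasure \<xi> A = 0} \<in> sets (sigma ?\<Omega> ?V)"
      using V by (auto simp: space_measure_of_conv void_def intro!: sigma_sets.Basic)
  qed (simp add: space_measure_of_conv)
  note ident = this
  have "A \<in> sets (sigma ?\<Omega> ?V)" if "A \<in> sets configuration_space" for A
    using measurable_sets[OF ident that] sets.sets_into_space[OF that] by (simp add: space_measure_of_conv Int_absorb2)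
  then show "sets configuration_space \<subseteq> sigma_sets ?\<Omega> ?V" using V by auto
qed

lemma Int_stable_void:
  "Int_stable {void A | A. A \<in> sets (borel::'x::polish_space measure) \<and> bounded A}" (is "Int_stable ?V")
proof (rule Int_stableI)
  fix a b assume "a \<in> ?V" "b \<in> ?V"
  then obtain A B where *: "a = void A" "b = void B" "A \<in> sets borel" "bounded A" "B \<in> sets borel" "bounded B"
    by blast
  then have "a \<inter> b = void (A \<union> B)" by (simp add: void_Int)
  moreover have "A \<union> B \<in> sets borel" "bounded (A \<union> B)" using * by auto
  ultimately show "a \<inter> b \<in> ?V" by blast
qed

lemma simple_counting_measures_void:
  "simple_counting_measures \<in> {void A | A. A \<in> sets (borel::'x::polish_space measure) \<and> bounded A}"
  by (rule CollectI, rule exI[of _ "{}"]) simp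

text \<open>
Renyi's theorem: a simple point process is determined by its void probabilities. Void events are
closed under intersection, because missing \<open>A\<close> and missing \<open>B\<close> means missing \<open>A \<union> B\<close>.
\<close>

lemma void_determines:
  fixes Q R :: "'x::polish_space measure measure"
  assumes Q: "sets Q = sets configuration_space" "prob_space Q"
    and R: "sets R = sets configuration_space"
    and eq: "\<And>A. A \<in> sets borel \<Longrightarrow> bounded A \<Longrightarrow> emeasure Q (void A) = emeasure R (void A)"
  shows "Q = R"
proof -
  let ?V = "{void A | A. A \<in> sets (borel::'x measure) \<and> bounded A}"
  interpret Q: prob_space Q by fact
  note top = simple_counting_measures_void
  show ?thesis
  proof (rule measure_eqI_generator_eq[where \<Omega>="simple_counting_measures" and E="?V"
        and A="\<lambda>_. simple_counting_measures"])
    show "Int_stable ?V" by (rule Int_stable_void)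
    show "range (\<lambda>_. simple_counting_measures) \<subseteq> ?V" using top by blast
    show "?V \<subseteq> Pow simple_counting_measures" by (auto simp: void_def)
  qed (use Q R eq in \<open>auto simp: sets_configuration_space_void\<close>)
qed

lemma void_rectangles_determine:
  fixes Q R :: "('y \<times> 'x::polish_space measure) measure"
  assumes Q: "sets Q = sets (N \<Otimes>\<^sub>M configuration_space)" "prob_space Q"
    and R: "sets R = sets (N \<Otimes>\<^sub>M configuration_space)"
    and eq: "\<And>B A. B \<in> sets N \<Longrightarrow> A \<in> sets borel \<Longrightarrow> bounded A \<Longrightarrow> emeasure Q (B \<times> void A) = emeasure R (B \<times> void A)"
  shows "Q = R"
proof -
  let ?V = "{void A | A. A \<in> sets (borel::'x measure) \<and> bounded A}"
  let ?E = "{B \<times> V | B V. B \<in> sets N \<and> V \<in> ?V}"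
  let ?\<Omega> = "space N \<times> (simple_counting_measures :: 'x measure set)"
  interpret Q: prob_space Q by fact
  note top = simple_counting_measures_void
  have sub: "?E \<subseteq> Pow ?\<Omega>" using sets.sets_into_space by (fastforce simp: void_def)
  have "sets (N \<Otimes>\<^sub>M configuration_space) =
      sets (sigma (space N \<times> space configuration_space) {a \<times> b | a b. a \<in> sets N \<and> b \<in> ?V})"
  proof (rule sets_pair_eq)
    show "sets N = sigma_sets (space N) (sets N)" by (simp add: sets.sigma_sets_eq)
    show "{space N} \<subseteq> sets N" by auto
    show "{simple_counting_measures} \<subseteq> ?V" using top by auto
    show "sets configuration_space = sigma_sets (space configuration_space) ?V"
      using sets_configuration_space_void by simp
  qed (auto simp: void_def sets.sets_into_space dest: sets.sets_into_space)
  then have gen: "sets (N \<Otimes>\<^sub>M configuration_space) = sigma_sets ?\<Omega> ?E"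
    using sub by simp
  show ?thesis
  proof (rule measure_eqI_generator_eq[where \<Omega>="?\<Omega>" and E="?E" and A="\<lambda>_. ?\<Omega>"])
    show "Int_stable ?E"
    proof (rule Int_stableI)
      fix a b assume "a \<in> ?E" "b \<in> ?E"
      then obtain B V B' V' where *: "a = B \<times> V" "b = B' \<times> V'" "B \<in> sets N" "B' \<in> sets N"
        "V \<in> ?V" "V' \<in> ?V" by blast
      have "V \<inter> V' \<in> ?V" by (rule Int_stableD[OF Int_stable_void *(5,6)])
      moreover have "a \<inter> b = (B \<inter> B') \<times> (V \<inter> V')" unfolding *(1,2) by (rule Times_Int_Times)
      ultimately show "a \<inter> b \<in> ?E" using *(3,4) by blast
    qed
    show "range (\<lambda>_. ?\<Omega>) \<subseteq> ?E" using top by blast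
  qed (use sub gen Q R eq in auto)
qed

section \<open>Thinning\<close>

definition coins :: "real \<Rightarrow> (nat \<Rightarrow> bool) measure" where
  "coins p = (\<Pi>\<^sub>M i\<in>UNIV. measure_pmf (bernoulli_pmf p))"

text \<open>
The index of the coin that is tossed for the point \<open>x\<close>. Different points of one configuration
have different addresses, which makes their coins independent, while the countable range of
addresses keeps everything measurable.
\<close>

definition address :: "'x::polish_space measure \<Rightarrow> 'x \<Rightarrow> nat" where
  "address \<xi> x = (LEAST i. atoms \<xi> \<inter> isolating_open i = {x})"

definition thin :: "'x::polish_space measure \<Rightarrow> (nat \<Rightarrow> bool) \<Rightarrow> 'x measure" where
  "thin \<xi> \<omega> = configuration {x \<in> atoms \<xi>. \<omega> (address \<xi> x)}"

lemma space_coins [simp]: "space (coins p) = UNIV"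
  by (simp add: coins_def space_PiM)

lemma prob_space_coins: "prob_space (coins p)"
  unfolding coins_def by (intro prob_space_PiM measure_pmf.prob_space_axioms)

lemma measurable_coin [measurable]: "Measurable.pred (coins p) (\<lambda>\<omega>. \<omega> i)"
proof -
  have "(\<lambda>\<omega>. \<omega> i) \<in> coins p \<rightarrow>\<^sub>M measure_pmf (bernoulli_pmf p)"
    unfolding coins_def by (rule measurable_component_singleton) simp
  then show ?thesis by (simp add: measurable_cong_sets[OF refl sets_measure_pmf_count_space])
qed

lemma suminf_indicator_of_nat:
  fixes f :: "nat \<Rightarrow> ennreal"
  shows "(\<Sum>j. f j * indicator {of_nat j :: ennreal} (of_nat n)) = f n"
proof -
  have "(\<Sum>j. f j * indicator {of_nat j :: ennreal} (of_nat n)) = (\<Sum>j\<in>{n}. f j * indicator {of_nat j :: ennreal} (of_nat n))"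
    by (rule suminf_finite) auto
  then show ?thesis by simp
qed

text \<open>
The series has at most one nonzero term: it is \<open>(1 - p)\<^sup>n\<close> if \<open>K\<close> has \<open>n\<close> elements, and \<open>0\<close>
if \<open>K\<close> is infinite. This form is the one that can be integrated termwise over random sets \<open>K\<close>.
\<close>

lemma coins_all_tails:
  assumes p: "0 < p" "p \<le> 1"
  shows "emeasure (coins p) {\<omega>. \<forall>i\<in>K. \<not> \<omega> i} =
    (\<Sum>j. ennreal ((1 - p) ^ j) * indicator {of_nat j} (emeasure (count_space UNIV) K))"
proof -
  interpret product_prob_space "\<lambda>_::nat. measure_pmf (bernoulli_pmf p)" UNIV
    by unfold_locales
  have fin: "emeasure (coins p) {\<omega>. \<forall>i\<in>F. \<not> \<omega> i} = ennreal ((1 - p) ^ card F)" if "finite F" for F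
  proof -
    have "emeasure (coins p) {\<omega>. \<forall>i\<in>F. \<not> \<omega> i} = emeasure (coins p) {\<omega> \<in> space (coins p). \<forall>i\<in>F. \<omega> i \<in> {False}}"
      by (intro arg_cong[where f="emeasure _"]) auto
    also have "\<dots> = (\<Prod>i\<in>F. emeasure (measure_pmf (bernoulli_pmf p)) {False})"
      unfolding coins_def using that by (intro emeasure_PiM_Collect) auto
    also have "\<dots> = ennreal ((1 - p) ^ card F)"
      using p by (simp add: emeasure_pmf_single ennreal_power)
    finally show ?thesis .
  qed
  have sets: "{\<omega>. \<forall>i\<in>K. \<not> \<omega> i} \<in> sets (coins p)" for K
  proof -
    have "{\<omega>\<in>space (coins p). \<forall>i. i \<in> K \<longrightarrow> \<not> \<omega> i} \<in> sets (coins p)" by measurable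
    then show ?thesis by (simp add: Ball_def)
  qed
  show ?thesis
  proof (cases "finite K")
    case True
    then show ?thesis by (simp add: emeasure_count_space suminf_indicator_of_nat fin)
  next
    case False
    have "emeasure (coins p) {\<omega>. \<forall>i\<in>K. \<not> \<omega> i} \<le> ennreal ((1 - p) ^ n)" for n
    proof -
      obtain F where F: "finite F" "card F = n" "F \<subseteq> K"
        using infinite_arbitrarily_large[OF False] by blast
      then have "emeasure (coins p) {\<omega>. \<forall>i\<in>K. \<not> \<omega> i} \<le> emeasure (coins p) {\<omega>. \<forall>i\<in>F. \<not> \<omega> i}"
        by (intro emeasure_mono sets) auto
      then show ?thesis using fin F by simp
    qed
    moreover have "(\<lambda>n. ennreal ((1 - p) ^ n)) \<longlonglongrightarrow> ennreal 0"
      using p by (intro tendsto_ennrealI LIMSEQ_power_zero) auto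
    ultimately have "emeasure (coins p) {\<omega>. \<forall>i\<in>K. \<not> \<omega> i} \<le> ennreal 0"
      by (intro LIMSEQ_le_const) auto
    then show ?thesis using False by (simp add: emeasure_count_space indicator_def)
  qed
qed

text \<open>
Only finitely many other atoms lie within distance \<open>1\<close> of \<open>x\<close>, and removing them from that ball
leaves an open neighbourhood of \<open>x\<close>.
\<close>

lemma address:
  assumes \<xi>: "\<xi> \<in> simple_counting_measures" and x: "x \<in> atoms \<xi>"
  shows "atoms \<xi> \<inter> isolating_open (address \<xi> x) = {x}"
proof -
  let ?F = "atoms \<xi> \<inter> ball x 1 - {x}"
  have "finite ?F" using locally_finite_atoms[OF \<xi>] by (auto simp: locally_finite_def)
  then have "open (ball x 1 - ?F)" by (intro open_Diff open_ball finite_imp_closed)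
  then obtain i where "x \<in> isolating_open i" "isolating_open i \<subseteq> ball x 1 - ?F"
    using isolatingE[of "ball x 1 - ?F" x] by auto
  then have "atoms \<xi> \<inter> isolating_open i = {x}" using x by auto
  then show ?thesis unfolding address_def by (rule LeastI)
qed

lemma inj_on_address:
  assumes "\<xi> \<in> simple_counting_measures"
  shows "inj_on (address \<xi>) (atoms \<xi>)"
proof (rule inj_onI)
  fix x y assume x: "x \<in> atoms \<xi>" and y: "y \<in> atoms \<xi>" and eq: "address \<xi> x = address \<xi> y"
  have "{x} = atoms \<xi> \<inter> isolating_open (address \<xi> x)" by (rule address[OF assms x, symmetric])
  also have "\<dots> = {y}" unfolding eq by (rule address[OF assms y])
  finally show "x = y" by (rule singleton_inject)
qed

lemma thin_in: "\<xi> \<in> simple_counting_measures \<Longrightarrow> thin \<xi> \<omega> \<in> simple_counting_measures"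
  unfolding thin_def
  by (rule configuration_in, rule locally_finite_subset[OF locally_finite_atoms]) auto

lemma emeasure_eq_1_iff:
  assumes "\<xi> \<in> simple_counting_measures" "A \<in> sets borel"
  shows "emeasure \<xi> A = 1 \<longleftrightarrow> (\<exists>x. atoms \<xi> \<inter> A = {x})"
  using assms by (auto simp: emeasure_atoms emeasure_count_space card_1_singleton_iff)

text \<open>
Addresses are defined through atoms. Expressed by counts, they depend measurably on the
configuration, and so does thinning.
\<close>

lemma ex_address_iff:
  assumes \<xi>: "\<xi> \<in> simple_counting_measures" and A: "A \<in> sets borel"
  shows "(\<exists>x\<in>atoms \<xi> \<inter> A. address \<xi> x = i) \<longleftrightarrow>
    emeasure \<xi> (isolating_open i) = 1 \<and> emeasure \<xi> (isolating_open i \<inter> A) \<noteq> 0 \<and>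
    (\<forall>j<i. \<not> (emeasure \<xi> (isolating_open j) = 1 \<and> emeasure \<xi> (isolating_open j \<inter> isolating_open i) \<noteq> 0))"
    (is "?L \<longleftrightarrow> ?R")
proof
  assume ?L
  then obtain x where x: "x \<in> atoms \<xi>" "x \<in> A" "address \<xi> x = i" by auto
  have 1: "atoms \<xi> \<inter> isolating_open i = {x}" using address[OF \<xi> x(1)] x(3) by simp
  have 2: "atoms \<xi> \<inter> isolating_open j \<noteq> {x}" if "j < i" for j
    using not_less_Least[of j "\<lambda>i. atoms \<xi> \<inter> isolating_open i = {x}"] that x(3) by (auto simp: address_def)
  have 3: "\<not> (emeasure \<xi> (isolating_open j) = 1 \<and> emeasure \<xi> (isolating_open j \<inter> isolating_open i) \<noteq> 0)"
    if "j < i" for j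
  proof
    assume *: "emeasure \<xi> (isolating_open j) = 1 \<and> emeasure \<xi> (isolating_open j \<inter> isolating_open i) \<noteq> 0"
    then obtain y where y: "atoms \<xi> \<inter> isolating_open j = {y}" using \<xi> by (auto simp: emeasure_eq_1_iff)
    have "atoms \<xi> \<inter> (isolating_open j \<inter> isolating_open i) \<noteq> {}" using * \<xi> by (simp add: void_iff)
    then obtain u where "u \<in> atoms \<xi> \<inter> isolating_open j" "u \<in> atoms \<xi> \<inter> isolating_open i" by auto
    then have "y = x" unfolding 1 y by simp
    then show False using 2[OF that] y by simp
  qed
  have "emeasure \<xi> (isolating_open i) = 1" using 1 \<xi> by (auto simp: emeasure_eq_1_iff)
  moreover have "emeasure \<xi> (isolating_open i \<inter> A) \<noteq> 0" using 1 x \<xi> A by (auto simp: void_iff)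
  ultimately show ?R using 3 by (intro conjI allI impI)
next
  assume R: ?R
  then obtain x where x: "atoms \<xi> \<inter> isolating_open i = {x}" using \<xi> by (auto simp: emeasure_eq_1_iff)
  then have xA: "x \<in> atoms \<xi>" "x \<in> A" using R \<xi> A by (auto simp: void_iff)
  have "\<not> atoms \<xi> \<inter> isolating_open j = {x}" if "j < i" for j
    using R that \<xi> x by (auto simp: emeasure_eq_1_iff void_iff)
  then have "address \<xi> x = i" unfolding address_def
    by (intro Least_equality x) (metis not_le)
  then show ?L using xA by auto
qed

lemma thin_void_iff:
  assumes "\<xi> \<in> simple_counting_measures" "A \<in> sets borel"
  shows "thin \<xi> \<omega> \<in> void A \<longleftrightarrow> (\<forall>i\<in>address \<xi> ` (atoms \<xi> \<inter> A). \<not> \<omega> i)"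
proof -
  have "thin \<xi> \<omega> \<in> void A \<longleftrightarrow> atoms (thin \<xi> \<omega>) \<inter> A = {}"
    using thin_in[OF assms(1)] assms(2) by (simp add: void_def void_iff)
  also have "\<dots> \<longleftrightarrow> (\<forall>i\<in>address \<xi> ` (atoms \<xi> \<inter> A). \<not> \<omega> i)"
    unfolding thin_def by auto
  finally show ?thesis .
qed

lemma measurable_thin [measurable]:
  "(\<lambda>(\<xi>, \<omega>). thin \<xi> \<omega>) \<in> configuration_space \<Otimes>\<^sub>M coins p \<rightarrow>\<^sub>M configuration_space"
proof (rule measurable_configurationI)
  let ?W = "configuration_space \<Otimes>\<^sub>M coins p"
  fix A :: "'a set" assume A [measurable]: "A \<in> sets borel" and "bounded A"
  let ?R = "\<lambda>\<xi> i. emeasure \<xi> (isolating_open i) = 1 \<and> emeasure \<xi> (isolating_open i \<inter> A) \<noteq> 0 \<and>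
    (\<forall>j<i. \<not> (emeasure \<xi> (isolating_open j) = 1 \<and> emeasure \<xi> (isolating_open j \<inter> isolating_open i) \<noteq> 0))"
  have "emeasure (case w of (\<xi>, \<omega>) \<Rightarrow> thin \<xi> \<omega>) A = 0 \<longleftrightarrow> (\<forall>i. ?R (fst w) i \<longrightarrow> \<not> snd w i)"
    if "w \<in> space ?W" for w
  proof -
    have \<xi>: "fst w \<in> simple_counting_measures" using that by (auto simp: space_pair_measure)
    have "emeasure (case w of (\<xi>, \<omega>) \<Rightarrow> thin \<xi> \<omega>) A = 0 \<longleftrightarrow> thin (fst w) (snd w) \<in> void A"
      using thin_in[OF \<xi>] by (simp add: void_def split: prod.splits)
    also have "\<dots> \<longleftrightarrow> (\<forall>i. (\<exists>x\<in>atoms (fst w) \<inter> A. address (fst w) x = i) \<longrightarrow> \<not> snd w i)"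
      unfolding thin_void_iff[OF \<xi> A] by blast
    finally show ?thesis unfolding ex_address_iff[OF \<xi> A] .
  qed
  then have "{w \<in> space ?W. emeasure (case w of (\<xi>, \<omega>) \<Rightarrow> thin \<xi> \<omega>) A = 0} =
      {w \<in> space ?W. \<forall>i. ?R (fst w) i \<longrightarrow> \<not> snd w i}" by blast
  also have "\<dots> \<in> sets ?W"
  proof -
    have [measurable]: "Measurable.pred ?W (\<lambda>w. snd w i)" for i
      by (rule measurable_compose[OF measurable_snd measurable_coin])
    have [measurable]: "(\<lambda>w. emeasure (fst w) B) \<in> borel_measurable ?W" if "B \<in> sets borel" for B
      by (rule measurable_compose[OF measurable_fst measurable_count[OF that]])
    show ?thesis by measurable
  qed
  finally show "{w \<in> space ?W. emeasure (case w of (\<xi>, \<omega>) \<Rightarrow> thin \<xi> \<omega>) A = 0} \<in> sets ?W" .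
qed (auto simp: space_pair_measure thin_in)

text \<open>
Given the configuration, the thinned one misses \<open>A\<close> iff the coins of all points in \<open>A\<close> show
\<^const>\<open>False\<close>. Hence void probabilities of the thinning are values at \<open>1 - p\<close> of the generating
function of the number of points in \<open>A\<close>.
\<close>

lemma emeasure_thin_void:
  assumes Q: "prob_space Q" and \<Xi> [measurable]: "\<Xi> \<in> Q \<rightarrow>\<^sub>M configuration_space"
    and D [measurable]: "D \<in> sets Q" and A [measurable]: "A \<in> sets borel" and p: "0 < p" "p \<le> 1"
  shows "emeasure (Q \<Otimes>\<^sub>M coins p) {z \<in> space (Q \<Otimes>\<^sub>M coins p). fst z \<in> D \<and> thin (\<Xi> (fst z)) (snd z) \<in> void A} =
    (\<Sum>j. ennreal ((1 - p) ^ j) * emeasure Q {w \<in> D. emeasure (\<Xi> w) A = of_nat j})"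
proof -
  interpret Q: prob_space Q by fact
  interpret c: prob_space "coins p" by (rule prob_space_coins)
  let ?E = "{z \<in> space (Q \<Otimes>\<^sub>M coins p). fst z \<in> D \<and> thin (\<Xi> (fst z)) (snd z) \<in> void A}"
  have [measurable]: "(\<lambda>z. thin (\<Xi> (fst z)) (snd z)) \<in> Q \<Otimes>\<^sub>M coins p \<rightarrow>\<^sub>M configuration_space"
    using measurable_compose[OF _ measurable_thin, of "\<lambda>z. (\<Xi> (fst z), snd z)" "Q \<Otimes>\<^sub>M coins p" p] by simp
  have [measurable]: "void A \<in> sets configuration_space" by (rule sets_void[OF A])
  have E: "?E \<in> sets (Q \<Otimes>\<^sub>M coins p)" by measurable
  have \<Xi>s: "\<Xi> w \<in> simple_counting_measures" if "w \<in> space Q" for w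
    using measurable_space[OF \<Xi> that] by simp
  have level: "{w \<in> D. emeasure (\<Xi> w) A = of_nat j} \<in> sets Q" for j :: nat
  proof -
    have "{w\<in>space Q. w \<in> D \<and> emeasure (\<Xi> w) A = of_nat j} \<in> sets Q" by measurable
    also have "{w\<in>space Q. w \<in> D \<and> emeasure (\<Xi> w) A = of_nat j} = {w \<in> D. emeasure (\<Xi> w) A = of_nat j}"
      using sets.sets_into_space[OF D] by auto
    finally show ?thesis .
  qed
  have "emeasure (Q \<Otimes>\<^sub>M coins p) ?E = (\<integral>\<^sup>+w. emeasure (coins p) (Pair w -` ?E) \<partial>Q)"
    by (rule c.emeasure_pair_measure_alt[OF E])
  also have "\<dots> = (\<integral>\<^sup>+w. (\<Sum>j. ennreal ((1 - p) ^ j) * indicator {w \<in> D. emeasure (\<Xi> w) A = of_nat j} w) \<partial>Q)"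
  proof (rule nn_integral_cong)
    fix w assume w: "w \<in> space Q"
    let ?K = "address (\<Xi> w) ` (atoms (\<Xi> w) \<inter> A)"
    show "emeasure (coins p) (Pair w -` ?E) =
      (\<Sum>j. ennreal ((1 - p) ^ j) * indicator {w \<in> D. emeasure (\<Xi> w) A = of_nat j} w)"
    proof (cases "w \<in> D")
      case True
      have inj: "inj_on (address (\<Xi> w)) (atoms (\<Xi> w) \<inter> A)"
        by (rule inj_on_subset[OF inj_on_address[OF \<Xi>s[OF w]]]) auto
      have K: "emeasure (count_space UNIV) ?K = emeasure (\<Xi> w) A"
        by (simp add: emeasure_atoms[OF \<Xi>s[OF w] A] emeasure_count_space card_image[OF inj] finite_image_iff[OF inj])
      have "Pair w -` ?E = {\<omega>. \<forall>i\<in>?K. \<not> \<omega> i}"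
        using True w by (auto simp: space_pair_measure thin_void_iff[OF \<Xi>s[OF w] A])
      moreover have "indicator {w \<in> D. emeasure (\<Xi> w) A = of_nat j} w =
          (indicator {of_nat j} (emeasure (\<Xi> w) A) :: ennreal)" for j
        using True by (auto simp: indicator_def)
      ultimately show ?thesis using coins_all_tails[OF p, of ?K] unfolding K by simp
    next
      case False
      then have "Pair w -` ?E = {}" by auto
      then show ?thesis using False by (simp add: indicator_def)
    qed
  qed
  also have "\<dots> = (\<Sum>j. \<integral>\<^sup>+w. ennreal ((1 - p) ^ j) * indicator {w \<in> D. emeasure (\<Xi> w) A = of_nat j} w \<partial>Q)"
  proof (rule nn_integral_suminf)
    fix j :: nat
    show "(\<lambda>w. ennreal ((1 - p) ^ j) * indicator {w \<in> D. emeasure (\<Xi> w) A = of_nat j} w) \<in> borel_measurable Q"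
      using level by simp
  qed
  also have "\<dots> = (\<Sum>j. ennreal ((1 - p) ^ j) * emeasure Q {w \<in> D. emeasure (\<Xi> w) A = of_nat j})"
  proof (intro suminf_cong)
    fix j :: nat
    show "(\<integral>\<^sup>+w. ennreal ((1 - p) ^ j) * indicator {w \<in> D. emeasure (\<Xi> w) A = of_nat j} w \<partial>Q) =
        ennreal ((1 - p) ^ j) * emeasure Q {w \<in> D. emeasure (\<Xi> w) A = of_nat j}"
      by (rule nn_integral_cmult_indicator[OF level])
  qed
  finally show ?thesis .
qed

section \<open>Superposition\<close>

text \<open>
The union of the sets of atoms, instead of the sum of the measures, gives a simple configuration
even if the arguments share atoms; on void events the two constructions agree.
\<close>

definition superpose :: "'x::polish_space measure \<Rightarrow> 'x measure \<Rightarrow> 'x measure" where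
  "superpose \<xi> \<eta> = configuration (atoms \<xi> \<union> atoms \<eta>)"

lemma superpose_in:
  "\<xi> \<in> simple_counting_measures \<Longrightarrow> \<eta> \<in> simple_counting_measures \<Longrightarrow> superpose \<xi> \<eta> \<in> simple_counting_measures"
  unfolding superpose_def by (intro configuration_in locally_finite_Un locally_finite_atoms)

lemma superpose_void_iff:
  assumes "\<xi> \<in> simple_counting_measures" "\<eta> \<in> simple_counting_measures" "A \<in> sets borel"
  shows "superpose \<xi> \<eta> \<in> void A \<longleftrightarrow> \<xi> \<in> void A \<and> \<eta> \<in> void A"
  using assms superpose_in[OF assms(1,2)] by (auto simp: void_def void_iff superpose_def)

lemma measurable_superpose [measurable]:
  "(\<lambda>(\<xi>, \<eta>). superpose \<xi> \<eta>) \<in> configuration_space \<Otimes>\<^sub>M configuration_space \<rightarrow>\<^sub>M configuration_space"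
proof (rule measurable_configurationI)
  let ?W = "configuration_space \<Otimes>\<^sub>M configuration_space"
  fix A :: "'a set" assume A: "A \<in> sets borel" and "bounded A"
  have "{w \<in> space ?W. emeasure (case w of (\<xi>, \<eta>) \<Rightarrow> superpose \<xi> \<eta>) A = 0} = void A \<times> void A"
  proof -
    have "emeasure (superpose \<xi> \<eta>) A = 0 \<longleftrightarrow> \<xi> \<in> void A \<and> \<eta> \<in> void A"
      if "\<xi> \<in> simple_counting_measures" "\<eta> \<in> simple_counting_measures" for \<xi> \<eta>
      using superpose_void_iff[OF that A] superpose_in[OF that] by (auto simp: void_def)
    then show ?thesis by (auto simp: space_pair_measure void_def)
  qed
  then show "{w \<in> space ?W. emeasure (case w of (\<xi>, \<eta>) \<Rightarrow> superpose \<xi> \<eta>) A = 0} \<in> sets ?W"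
    using A by simp
qed (auto simp: space_pair_measure superpose_in)

section \<open>Poisson counts\<close>

lemma poisson_lawD:
  assumes "poisson_law m P"
  shows "sets P = sets configuration_space" "prob_space P" "space P = simple_counting_measures"
  using assms sets_eq_imp_space_eq[of P configuration_space] by (auto simp: poisson_law_def)

lemma poisson_count:
  assumes P: "poisson_law m P" and A: "A \<in> sets m" "emeasure m A < \<infinity>"
  shows "emeasure P {\<xi>\<in>simple_counting_measures. emeasure \<xi> A = of_nat j} =
    ennreal (exp (- measure m A) * measure m A ^ j / fact j)"
proof -
  interpret prob_space P by (rule poisson_lawD(2)[OF P])
  have "\<forall>(k::nat) A. (\<forall>i<k. A i \<in> sets m \<and> emeasure m (A i) < \<infinity>) \<and> disjoint_family_on A {..<k} \<longrightarrow>
      (\<forall>i<k. \<forall>j::nat. measure P {\<xi>\<in>space P. emeasure \<xi> (A i) = of_nat j} =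
        exp (- measure m (A i)) * measure m (A i) ^ j / fact j)"
    using P unfolding poisson_law_def by blast
  from this[rule_format, of 1 "\<lambda>_. A" 0 j]
  have "measure P {\<xi>\<in>space P. emeasure \<xi> A = of_nat j} = exp (- measure m A) * measure m A ^ j / fact j"
    using A by (auto simp: disjoint_family_on_def)
  then show ?thesis by (simp add: emeasure_eq_measure poisson_lawD(3)[OF P])
qed

lemma poisson_generating_function:
  assumes P: "poisson_law m P" and A: "A \<in> sets m" "emeasure m A < \<infinity>" and z: "0 \<le> z"
  shows "(\<Sum>j. ennreal (z ^ j) * emeasure P {\<xi>\<in>simple_counting_measures. emeasure \<xi> A = of_nat j}) =
    ennreal (exp (- (1 - z) * measure m A))"
proof -
  let ?m = "measure m A"
  have "(\<Sum>j. ennreal (z ^ j) * emeasure P {\<xi>\<in>simple_counting_measures. emeasure \<xi> A = of_nat j}) =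
      (\<Sum>j. ennreal (exp (- ?m) * ((z * ?m) ^ j /\<^sub>R fact j)))"
    using z by (intro suminf_cong)
      (simp add: poisson_count[OF P A] ennreal_mult[symmetric] power_mult_distrib field_simps)
  also have "\<dots> = ennreal (exp (- ?m) * exp (z * ?m))"
    using z by (intro suminf_ennreal_eq sums_mult exp_converges) auto
  also have "exp (- ?m) * exp (z * ?m) = exp (- (1 - z) * ?m)"
    by (simp add: exp_add[symmetric] algebra_simps)
  finally show ?thesis .
qed

lemma poisson_void:
  assumes P: "poisson_law m P" and A: "A \<in> sets m" "emeasure m A < \<infinity>"
  shows "emeasure P (void A) = ennreal (exp (- measure m A))"
  using poisson_count[OF P A, of 0] by (simp add: void_def)

lemma poisson_AE_finite:
  assumes P: "poisson_law m P" and m: "sets m = sets borel" and A: "A \<in> sets m" "emeasure m A < \<infinity>"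
  shows "AE \<xi> in P. emeasure \<xi> A < \<infinity>"
proof -
  interpret prob_space P by (rule poisson_lawD(2)[OF P])
  note [measurable_cong] = poisson_lawD(1)[OF P]
  have [measurable]: "A \<in> sets borel" using A m by simp
  let ?E = "\<lambda>j::nat. {\<xi>\<in>simple_counting_measures. emeasure \<xi> A = of_nat j}"
  have E: "?E j \<in> sets P" for j
  proof -
    have "{\<xi>\<in>space P. emeasure \<xi> A = of_nat j} \<in> sets P" by measurable
    then show ?thesis by (simp add: poisson_lawD(3)[OF P])
  qed
  have "emeasure P (\<Union>j. ?E j) = (\<Sum>j. emeasure P (?E j))"
    using E by (intro suminf_emeasure[symmetric]) (auto simp: disjoint_family_on_def)
  also have "\<dots> = 1" using poisson_generating_function[OF P A, of 1] by simp
  finally have "AE \<xi> in P. \<xi> \<in> (\<Union>j. ?E j)"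
    using E by (subst AE_in_set_eq_1) (auto simp: emeasure_eq_measure simp del: UN_iff)
  then show ?thesis by eventually_elim (auto simp: of_nat_less_top)
qed

section \<open>The suspension map\<close>

lemma emeasure_suspension:
  assumes "\<xi> \<in> simple_counting_measures" "T \<in> borel \<rightarrow>\<^sub>M borel" "A \<in> sets borel"
  shows "emeasure (suspension_map T \<xi>) A = emeasure \<xi> (T -` A)"
proof -
  have s: "sets \<xi> = sets borel" by (rule sets_simple_counting[OF assms(1)])
  then have "space \<xi> = UNIV" using sets_eq_imp_space_eq[OF s] by simp
  then show ?thesis
    using assms(2,3) s by (simp add: suspension_map_def emeasure_distr measurable_cong_sets[OF s refl])
qed

text \<open>
The configurations whose image under \<^term>\<open>suspension_map T\<close> is again boundedly finite.
\<close>

definition finite_preimages :: "('x::polish_space \<Rightarrow> 'x) \<Rightarrow> 'x measure set" where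
  "finite_preimages T =
     {\<xi>\<in>simple_counting_measures. \<forall>n. emeasure \<xi> (T -` ball undefined (real n)) < \<infinity>}"

lemma measurable_vimage: "T \<in> borel \<rightarrow>\<^sub>M borel \<Longrightarrow> A \<in> sets borel \<Longrightarrow> T -` A \<in> sets borel"
  using measurable_sets[of T borel borel A] by simp

lemma suspension_in_iff:
  assumes \<xi>: "\<xi> \<in> simple_counting_measures" and T: "bij T" "T \<in> borel \<rightarrow>\<^sub>M borel"
  shows "suspension_map T \<xi> \<in> simple_counting_measures \<longleftrightarrow> \<xi> \<in> finite_preimages T"
proof
  assume *: "suspension_map T \<xi> \<in> simple_counting_measures"
  have "emeasure (suspension_map T \<xi>) (ball undefined (real n)) < \<infinity>" for n
    using * by (auto simp: simple_counting_measures_def boundedly_finite_def)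
  then show "\<xi> \<in> finite_preimages T"
    using \<xi> T(2) by (simp add: finite_preimages_def emeasure_suspension)
next
  assume F: "\<xi> \<in> finite_preimages T"
  have img: "T ` atoms \<xi> \<inter> A = T ` (atoms \<xi> \<inter> T -` A)" for A by auto
  have inj: "inj_on T K" for K using T(1) by (auto simp: bij_def intro: inj_on_subset)
  show "suspension_map T \<xi> \<in> simple_counting_measures"
  proof (rule simple_counting_measuresI)
    show "sets (suspension_map T \<xi>) = sets borel" by (simp add: suspension_map_def)
    show "locally_finite (T ` atoms \<xi>)"
      unfolding locally_finite_def
    proof (intro ballI impI)
      fix A :: "'a set" assume A: "A \<in> sets borel" "bounded A"
      obtain r where r: "\<And>y. y \<in> A \<Longrightarrow> dist undefined y \<le> r"
        using A(2) unfolding bounded_any_center[of A undefined] by blast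
      obtain n where "r < real n" using reals_Archimedean2 by blast
      then have "A \<subseteq> ball undefined (real n)" using r by force
      moreover have "finite (atoms \<xi> \<inter> T -` ball undefined (real n))"
      proof -
        have "emeasure \<xi> (T -` ball undefined (real n)) < \<infinity>" using F by (simp add: finite_preimages_def)
        then show ?thesis
          using emeasure_atoms[OF \<xi> measurable_vimage[OF T(2)], of "ball undefined (real n)"]
          by (auto simp: emeasure_count_space split: if_splits)
      qed
      ultimately have "finite (atoms \<xi> \<inter> T -` A)" by (elim finite_subset[rotated]) auto
      then show "finite (T ` atoms \<xi> \<inter> A)" by (simp add: img)
    qed
    fix A :: "'a set" assume A: "A \<in> sets borel"
    show "emeasure (suspension_map T \<xi>) A = emeasure (count_space UNIV) (T ` atoms \<xi> \<inter> A)"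
      by (simp add: emeasure_suspension[OF \<xi> T(2) A] emeasure_atoms[OF \<xi> measurable_vimage[OF T(2) A]]
          img emeasure_count_space finite_image_iff[OF inj] card_image[OF inj])
  qed
qed

lemma sets_finite_preimages:
  assumes T: "T \<in> borel \<rightarrow>\<^sub>M borel"
  shows "finite_preimages T \<in> sets configuration_space"
proof -
  have [measurable]: "T -` ball undefined (real n) \<in> sets borel" for n
    by (rule measurable_vimage[OF T]) simp
  have "{\<xi>\<in>space configuration_space. \<forall>n. emeasure \<xi> (T -` ball undefined (real n)) < \<infinity>}
      \<in> sets configuration_space" by measurable
  then show ?thesis by (simp add: finite_preimages_def)
qed

text \<open>
Void rectangles suffice for invariance as well. Where the suspension map leaves the configuration
space it is replaced by a constant, which gives a globally measurable map that agrees with it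
almost everywhere.
\<close>

lemma invariant_suspensionI:
  fixes J :: "('y \<times> 'x::polish_space measure) measure"
  assumes J: "prob_space J" "sets J = sets (N \<Otimes>\<^sub>M configuration_space)"
    and S [measurable]: "S \<in> N \<rightarrow>\<^sub>M N" and T: "bij T" "T \<in> borel \<rightarrow>\<^sub>M borel"
    and ae: "AE z in J. snd z \<in> finite_preimages T"
    and eq: "\<And>B A. B \<in> sets N \<Longrightarrow> A \<in> sets borel \<Longrightarrow> bounded A \<Longrightarrow>
      emeasure J ((S -` B \<inter> space N) \<times> void (T -` A)) = emeasure J (B \<times> void A)"
  shows "invariant_measure J (map_prod S (suspension_map T))"
proof -
  interpret J: prob_space J by fact
  let ?C = "configuration_space :: 'x measure measure"
  let ?F = "finite_preimages T"
  note [measurable] = sets_finite_preimages[OF T(2)]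
  note [measurable_cong] = J(2)
  have spJ: "space J = space N \<times> simple_counting_measures"
    using sets_eq_imp_space_eq[OF J(2)] by (simp add: space_pair_measure)
  have Fsub: "?F \<subseteq> simple_counting_measures" by (auto simp: finite_preimages_def)
  \<comment> \<open>The substitute for the suspension map; the empty configuration is an arbitrary choice.\<close>
  define U where "U \<xi> = (if \<xi> \<in> ?F then suspension_map T \<xi> else configuration {})" for \<xi>
  have Uin: "U \<xi> \<in> simple_counting_measures" for \<xi>
    using suspension_in_iff[OF _ T, of \<xi>] Fsub
    by (auto simp: U_def intro!: configuration_in simp: locally_finite_def)
  have [measurable]: "U \<in> ?C \<rightarrow>\<^sub>M ?C"
  proof (rule measurable_configurationI)
    fix A :: "'x set" assume A: "A \<in> sets borel"
    have "{\<xi>\<in>space ?C. emeasure (U \<xi>) A = 0} = (space ?C - ?F) \<union> (?F \<inter> void (T -` A))"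
      using Fsub A T(2)
      by (auto simp: U_def void_def emeasure_suspension emeasure_configuration subset_eq)
    also have "\<dots> \<in> sets ?C"
      using sets_void[OF measurable_vimage[OF T(2) A]] sets_finite_preimages[OF T(2)]
      by (intro sets.Un sets.Int sets.Diff sets.top)
    finally show "{\<xi>\<in>space ?C. emeasure (U \<xi>) A = 0} \<in> sets ?C" .
  qed (rule Uin)
  define g where "g = map_prod S U"
  have g [measurable]: "g \<in> J \<rightarrow>\<^sub>M N \<Otimes>\<^sub>M ?C"
    unfolding g_def map_prod_def split_beta' by measurable
  have aeF: "AE z in J. z \<in> A \<longleftrightarrow> z \<in> B" if "\<And>z. z \<in> space J \<Longrightarrow> snd z \<in> ?F \<Longrightarrow> z \<in> A \<longleftrightarrow> z \<in> B" for A B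
    using ae AE_space by eventually_elim (use that in auto)
  have "distr J (N \<Otimes>\<^sub>M ?C) g = J"
  proof (rule void_rectangles_determine)
    show "prob_space (distr J (N \<Otimes>\<^sub>M ?C) g)" by (rule J.prob_space_distr[OF g])
    fix B and A :: "'x set" assume B: "B \<in> sets N" and A: "A \<in> sets borel" and bA: "bounded A"
    have BA: "B \<times> void A \<in> sets (N \<Otimes>\<^sub>M ?C)" using B sets_void[OF A] by simp
    have "emeasure (distr J (N \<Otimes>\<^sub>M ?C) g) (B \<times> void A) = emeasure J (g -` (B \<times> void A) \<inter> space J)"
      by (rule emeasure_distr[OF g BA])
    also have "\<dots> = emeasure J ((S -` B \<inter> space N) \<times> void (T -` A))"
    proof (rule emeasure_eq_AE)
      show "AE z in J. z \<in> g -` (B \<times> void A) \<inter> space J \<longleftrightarrow> z \<in> (S -` B \<inter> space N) \<times> void (T -` A)"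
      proof (rule aeF)
        fix z assume z: "z \<in> space J" "snd z \<in> ?F"
        obtain y \<xi> where [simp]: "z = (y, \<xi>)" by (cases z)
        have "\<xi> \<in> simple_counting_measures" using z Fsub by auto
        then have "U \<xi> \<in> void A \<longleftrightarrow> \<xi> \<in> void (T -` A)"
          using z Uin[of \<xi>] A T(2) by (simp add: void_def U_def emeasure_suspension)
        then show "z \<in> g -` (B \<times> void A) \<inter> space J \<longleftrightarrow> z \<in> (S -` B \<inter> space N) \<times> void (T -` A)"
          using z by (auto simp: g_def spJ)
      qed
      show "g -` (B \<times> void A) \<inter> space J \<in> sets J" by (rule measurable_sets[OF g BA])
      show "(S -` B \<inter> space N) \<times> void (T -` A) \<in> sets J"
        using measurable_sets[OF S B] sets_void[OF measurable_vimage[OF T(2) A]] by (simp add: J(2))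
    qed
    also have "\<dots> = emeasure J (B \<times> void A)" by (rule eq[OF B A bA])
    finally show "emeasure (distr J (N \<Otimes>\<^sub>M ?C) g) (B \<times> void A) = emeasure J (B \<times> void A)" .
  qed (use J in simp_all)
  note dist = this
  show ?thesis unfolding invariant_measure_def
  proof (intro ballI)
    fix E assume E: "E \<in> sets J"
    let ?f = "map_prod S (suspension_map T)"
    \<comment> \<open>Outside \<open>?F\<close> the suspension map leaves the configuration space, hence avoids \<open>E\<close>.\<close>
    have EF: "?f -` E \<inter> space J = g -` E \<inter> space J \<inter> (space N \<times> ?F)"
    proof -
      have 1: "?f (y, \<xi>) \<in> E \<longleftrightarrow> g (y, \<xi>) \<in> E \<and> \<xi> \<in> ?F" if "(y, \<xi>) \<in> space J" for y \<xi>
      proof (cases "\<xi> \<in> ?F")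
        case False
        then have "suspension_map T \<xi> \<notin> simple_counting_measures"
          using that suspension_in_iff[OF _ T, of \<xi>] by (auto simp: spJ)
        then have "?f (y, \<xi>) \<notin> E" using sets.sets_into_space[OF E] by (auto simp: spJ)
        then show ?thesis using False by simp
      qed (simp add: g_def U_def)
      have 2: "(y, \<xi>) \<in> space N \<times> ?F \<longleftrightarrow> \<xi> \<in> ?F" if "(y, \<xi>) \<in> space J" for y \<xi>
        using that by (simp add: spJ)
      show ?thesis
      proof (rule set_eqI)
        fix z :: "'y \<times> 'x measure"
        obtain y \<xi> where z: "z = (y, \<xi>)" by (cases z)
        show "z \<in> ?f -` E \<inter> space J \<longleftrightarrow> z \<in> g -` E \<inter> space J \<inter> (space N \<times> ?F)"
          unfolding z Int_iff vimage_eq using 1[of y \<xi>] 2[of y \<xi>] by argo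
      qed
    qed
    have gE: "g -` E \<inter> space J \<in> sets J" using E by (intro measurable_sets[OF g]) (simp add: J(2))
    have fE: "?f -` E \<inter> space J \<in> sets J" unfolding EF
      by (rule sets.Int[OF gE]) (simp add: J(2) sets_finite_preimages[OF T(2)])
    have "emeasure J (?f -` E \<inter> space J) = emeasure J (g -` E \<inter> space J)"
    proof (rule emeasure_eq_AE[OF aeF fE gE])
      fix z assume "z \<in> space J" "snd z \<in> ?F"
      then have "z \<in> space N \<times> ?F" by (auto simp: spJ)
      then show "z \<in> ?f -` E \<inter> space J \<longleftrightarrow> z \<in> g -` E \<inter> space J" unfolding EF by blast
    qed
    also have "\<dots> = emeasure (distr J (N \<Otimes>\<^sub>M ?C) g) E"
      using E by (intro emeasure_distr[OF g, symmetric]) (simp add: J(2))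
    finally show "?f -` E \<inter> space J \<in> sets J \<and> emeasure J (?f -` E \<inter> space J) = emeasure J E"
      using fE dist by simp
  qed
qed

text \<open>
The converse direction for counts: an invariant law assigns equal generating functions to \<open>(B, A)\<close>
and to its preimage, and thinning passes this on to void rectangles.
\<close>

lemma invariant_suspension_count:
  fixes J :: "('y \<times> 'x::polish_space measure) measure"
  assumes J: "prob_space J" "sets J = sets (N \<Otimes>\<^sub>M configuration_space)"
    and T: "bij T" "T \<in> borel \<rightarrow>\<^sub>M borel" and S: "S \<in> N \<rightarrow>\<^sub>M N"
    and ae: "AE z in J. snd z \<in> finite_preimages T"
    and inv: "invariant_measure J (map_prod S (suspension_map T))"
    and B: "B \<in> sets N" and A: "A \<in> sets borel"
  shows "emeasure J ((S -` B \<inter> space N) \<times> {\<xi>\<in>simple_counting_measures. emeasure \<xi> (T -` A) = c}) =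
    emeasure J (B \<times> {\<xi>\<in>simple_counting_measures. emeasure \<xi> A = c})"
proof -
  let ?f = "map_prod S (suspension_map T)"
  let ?V = "\<lambda>A. {\<xi>\<in>simple_counting_measures. emeasure \<xi> A = c}"
  have spJ: "space J = space N \<times> simple_counting_measures"
    using sets_eq_imp_space_eq[OF J(2)] by (simp add: space_pair_measure)
  have V: "?V A \<in> sets configuration_space" if [measurable]: "A \<in> sets borel" for A
  proof -
    have "{\<xi>\<in>space configuration_space. emeasure \<xi> A = c} \<in> sets configuration_space" by measurable
    then show ?thesis by simp
  qed
  have BV: "B \<times> ?V A \<in> sets J" using B V[OF A] by (simp add: J(2))
  have "emeasure J (?f -` (B \<times> ?V A) \<inter> space J) = emeasure J ((S -` B \<inter> space N) \<times> ?V (T -` A))"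
  proof (rule emeasure_eq_AE)
    show "?f -` (B \<times> ?V A) \<inter> space J \<in> sets J" using inv BV by (simp add: invariant_measure_def)
    show "(S -` B \<inter> space N) \<times> ?V (T -` A) \<in> sets J"
      using measurable_sets[OF S B] V[OF measurable_vimage[OF T(2) A]] by (simp add: J(2))
    show "AE z in J. z \<in> ?f -` (B \<times> ?V A) \<inter> space J \<longleftrightarrow> z \<in> (S -` B \<inter> space N) \<times> ?V (T -` A)"
      using ae AE_space
    proof eventually_elim
      fix z assume z: "snd z \<in> finite_preimages T" "z \<in> space J"
      then show "z \<in> ?f -` (B \<times> ?V A) \<inter> space J \<longleftrightarrow> z \<in> (S -` B \<inter> space N) \<times> ?V (T -` A)"
        using suspension_in_iff[OF _ T, of "snd z"] emeasure_suspension[OF _ T(2) A, of "snd z"]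
        by (auto simp: spJ)
    qed
  qed
  moreover have "emeasure J (?f -` (B \<times> ?V A) \<inter> space J) = emeasure J (B \<times> ?V A)"
    using inv BV by (simp add: invariant_measure_def)
  ultimately show ?thesis by simp
qed

section \<open>Power series that agree on an interval\<close>

text \<open>
The interval need not be near \<open>0\<close>, so the identity at \<open>0\<close> comes from analytic continuation
over the unit disc.
\<close>

lemma power_series_interval_eq:
  fixes a b :: "nat \<Rightarrow> real"
  assumes a: "summable (\<lambda>n. \<bar>a n\<bar>)" and b: "summable (\<lambda>n. \<bar>b n\<bar>)" and r: "0 \<le> r" "r < 1"
    and eq: "\<And>z. r < z \<Longrightarrow> z < 1 \<Longrightarrow> (\<Sum>n. a n * z ^ n) = (\<Sum>n. b n * z ^ n)"
  shows "a 0 = b 0"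
proof -
  define d where "d n = complex_of_real (a n - b n)" for n
  have "norm (d n) \<le> \<bar>a n\<bar> + \<bar>b n\<bar>" for n
    unfolding d_def norm_of_real by (rule abs_triangle_ineq4)
  then have sd: "summable (\<lambda>n. norm (d n))"
    by (intro summable_comparison_test'[OF summable_add[OF a b], of 0]) auto
  have sm: "summable (\<lambda>n. d n * w ^ n)" if "norm w \<le> 1" for w
    by (rule summable_norm_cancel, rule summable_comparison_test'[OF sd, of 0])
      (use that in \<open>auto simp: norm_mult norm_power intro!: mult_left_le power_le_one\<close>)
  define f where "f w = (\<Sum>n. d n * w ^ n)" for w
  have hol: "f holomorphic_on ball 0 1"
    by (rule power_series_holomorphic[where a=d]) (auto simp: f_def intro!: summable_sums sm)
  have "f 0 = 0"
  proof (rule analytic_continuation[OF hol open_ball connected_ball])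
    let ?U = "complex_of_real ` {r<..<1}"
    show "?U \<subseteq> ball 0 1" using r by auto
    show "complex_of_real ((r + 1) / 2) \<in> ball 0 1" using r by (auto simp: norm_of_real simp del: of_real_divide of_real_add)
    show "complex_of_real ((r + 1) / 2) islimpt ?U"
    proof (rule islimpt_isCont_image)
      show "(r + 1) / 2 islimpt {r<..<1}" using r by (intro interior_limit_point) (simp add: interior_open)
      show "isCont complex_of_real ((r + 1) / 2)" by (intro continuous_intros)
      show "eventually (\<lambda>y. complex_of_real y \<noteq> complex_of_real ((r + 1) / 2)) (at ((r + 1) / 2))"
        by (auto simp: eventually_at_filter simp del: of_real_divide of_real_add)
    qed
    show "f w = 0" if "w \<in> ?U" for w
    proof -
      obtain z where z: "w = complex_of_real z" "r < z" "z < 1" using \<open>w \<in> ?U\<close> by auto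
      have sz: "summable (\<lambda>n. c n * z ^ n)" if "summable (\<lambda>n. \<bar>c n :: real\<bar>)" for c
        by (rule summable_comparison_test'[OF that, of 0])
          (use z r in \<open>auto simp: abs_mult power_abs intro!: mult_left_le power_le_one\<close>)
      have "f w = (\<Sum>n. complex_of_real (a n * z ^ n - b n * z ^ n))"
        unfolding f_def d_def z(1) by (simp add: algebra_simps)
      also have "\<dots> = complex_of_real ((\<Sum>n. a n * z ^ n) - (\<Sum>n. b n * z ^ n))"
        using sz[OF a] sz[OF b] by (subst suminf_of_real[symmetric]) (auto simp: suminf_diff intro!: summable_diff)
      also have "\<dots> = 0" using eq z by simp
      finally show ?thesis .
    qed
  qed auto
  then show ?thesis by (simp add: f_def d_def)
qed

section \<open>Disjointness passes to all intensities\<close>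

lemma joiningD:
  assumes "joining M f N g J"
  shows "sets J = sets (M \<Otimes>\<^sub>M N)" "prob_space J" "invariant_measure J (map_prod f g)"
    "distr J M fst = M" "distr J N snd = N"
  using assms by (auto simp: joining_def)

text \<open>
By invariance the preimages of balls have finite measure, so that a Poisson configuration almost
surely has finitely many points in each of them.
\<close>

lemma AE_marginal_finite_preimages:
  assumes T: "T \<in> borel \<rightarrow>\<^sub>M borel" and m: "sets m = sets borel" "boundedly_finite m" "invariant_measure m T"
    and P: "poisson_law m P" and J: "sets J = sets (N \<Otimes>\<^sub>M configuration_space)" "distr J P snd = P"
  shows "AE z in J. snd z \<in> finite_preimages T"
proof -
  have sp: "space m = UNIV" using sets_eq_imp_space_eq[OF m(1)] by simp
  have "AE \<xi> in P. emeasure \<xi> (T -` ball undefined (real n)) < \<infinity>" for n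
  proof (rule poisson_AE_finite[OF P m(1)])
    have b: "ball undefined (real n) \<in> sets m" by (simp add: m(1))
    show "T -` ball undefined (real n) \<in> sets m"
      using measurable_vimage[OF T, of "ball undefined (real n)"] by (simp add: m(1))
    show "emeasure m (T -` ball undefined (real n)) < \<infinity>"
      using m(2,3) b by (auto simp: invariant_measure_def boundedly_finite_def sp)
  qed
  then have "AE \<xi> in P. \<forall>n. emeasure \<xi> (T -` ball undefined (real n)) < \<infinity>"
    by (simp add: AE_all_countable)
  then have "AE \<xi> in P. \<xi> \<in> finite_preimages T"
    using AE_space by eventually_elim (simp add: finite_preimages_def poisson_lawD(3)[OF P])
  then have *: "AE \<xi> in distr J P snd. \<xi> \<in> finite_preimages T" by (simp only: J(2))
  have snd: "snd \<in> J \<rightarrow>\<^sub>M P"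
    unfolding measurable_cong_sets[OF J(1) poisson_lawD(1)[OF P]] by (rule measurable_snd)
  have "{\<xi>\<in>space P. \<xi> \<in> finite_preimages T} = finite_preimages T"
    by (auto simp: poisson_lawD(3)[OF P] finite_preimages_def)
  then have "{\<xi>\<in>space P. \<xi> \<in> finite_preimages T} \<in> sets P"
    by (simp add: poisson_lawD(1)[OF P] sets_finite_preimages[OF T])
  with * show ?thesis by (simp add: AE_distr_iff[OF snd])
qed

text \<open>
The second coordinate of a random pair with law \<open>J\<close> keeps each point with probability \<open>p\<close> and is
then superposed with an independent configuration of law \<open>P\<close> that keeps each point with
probability \<open>q\<close>; \<open>K\<close> is the law of the resulting pair. The layers are independent, so their void
probabilities multiply.
\<close>

lemma thin_and_superpose:
  fixes J :: "('y \<times> 'x::polish_space measure) measure" and P :: "'x measure measure"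
  assumes J: "prob_space J" "sets J = sets (N \<Otimes>\<^sub>M configuration_space)"
    and P: "prob_space P" "sets P = sets configuration_space"
    and p: "0 < p" "p \<le> 1" and q: "0 < q" "q \<le> 1"
  obtains K where "prob_space K" "sets K = sets (N \<Otimes>\<^sub>M configuration_space)"
    "\<And>B A. B \<in> sets N \<Longrightarrow> A \<in> sets borel \<Longrightarrow> emeasure K (B \<times> void A) =
      (\<Sum>j. ennreal ((1 - p) ^ j) * emeasure J (B \<times> {\<xi>\<in>simple_counting_measures. emeasure \<xi> A = of_nat j})) *
      (\<Sum>j. ennreal ((1 - q) ^ j) * emeasure P {\<xi>\<in>simple_counting_measures. emeasure \<xi> A = of_nat j})"
proof -
  let ?C = "configuration_space :: 'x measure measure"
  interpret J: prob_space J by fact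
  interpret P: prob_space P by fact
  interpret cp: prob_space "coins p" by (rule prob_space_coins)
  interpret cq: prob_space "coins q" by (rule prob_space_coins)
  interpret Jp: pair_prob_space J "coins p" ..
  interpret Pq: pair_prob_space P "coins q" ..
  note [measurable_cong] = J(2) P(2)
  have spJ: "space J = space N \<times> simple_counting_measures"
    using sets_eq_imp_space_eq[OF J(2)] by (simp add: space_pair_measure)
  have spP: "space P = simple_counting_measures"
    using sets_eq_imp_space_eq[OF P(2)] by simp
  have sndJ: "snd \<in> J \<rightarrow>\<^sub>M ?C" by measurable
  have idP: "(\<lambda>\<xi>. \<xi>) \<in> P \<rightarrow>\<^sub>M ?C" by measurable
  define f where "f = (\<lambda>z :: ('y \<times> 'x measure) \<times> (nat \<Rightarrow> bool). (fst (fst z), thin (snd (fst z)) (snd z)))"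
  define g where "g = (\<lambda>z :: 'x measure \<times> (nat \<Rightarrow> bool). thin (fst z) (snd z))"
  have f [measurable]: "f \<in> J \<Otimes>\<^sub>M coins p \<rightarrow>\<^sub>M N \<Otimes>\<^sub>M ?C"
    using measurable_compose[OF _ measurable_thin, of "\<lambda>z. (snd (fst z), snd z)" "J \<Otimes>\<^sub>M coins p" p]
    unfolding f_def by simp
  have g [measurable]: "g \<in> P \<Otimes>\<^sub>M coins q \<rightarrow>\<^sub>M ?C"
    using measurable_compose[OF _ measurable_thin, of "\<lambda>z. z" "P \<Otimes>\<^sub>M coins q" q]
    unfolding g_def by (simp add: split_beta')
  define V where "V = distr (J \<Otimes>\<^sub>M coins p) (N \<Otimes>\<^sub>M ?C) f"
  define W where "W = distr (P \<Otimes>\<^sub>M coins q) ?C g"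
  interpret V: prob_space V unfolding V_def by (rule Jp.prob_space_distr[OF f])
  interpret W: prob_space W unfolding W_def by (rule Pq.prob_space_distr[OF g])
  interpret VW: pair_prob_space V W ..
  have sets_VW [measurable_cong, simp]: "sets V = sets (N \<Otimes>\<^sub>M ?C)" "sets W = sets ?C"
    by (simp_all add: V_def W_def)
  define h where "h = (\<lambda>z :: ('y \<times> 'x measure) \<times> 'x measure. (fst (fst z), superpose (snd (fst z)) (snd z)))"
  have h: "h \<in> V \<Otimes>\<^sub>M W \<rightarrow>\<^sub>M N \<Otimes>\<^sub>M ?C"
    using measurable_compose[OF _ measurable_superpose, of "\<lambda>z. (snd (fst z), snd z)" "V \<Otimes>\<^sub>M W"]
    unfolding h_def by simp
  have V: "emeasure V (B \<times> void A) =
      (\<Sum>j. ennreal ((1 - p) ^ j) * emeasure J (B \<times> {\<xi>\<in>simple_counting_measures. emeasure \<xi> A = of_nat j}))"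
    if B: "B \<in> sets N" and A: "A \<in> sets borel" for B A
  proof -
    let ?D = "B \<times> simple_counting_measures"
    have slice: "{w \<in> ?D. emeasure (snd w) A = of_nat j} =
        B \<times> {\<xi>\<in>simple_counting_measures. emeasure \<xi> A = of_nat j}" for j :: nat
      by auto
    have D: "?D \<in> sets J" using B sets.top[of ?C] by (simp add: J(2))
    have "emeasure V (B \<times> void A) = emeasure (J \<Otimes>\<^sub>M coins p) (f -` (B \<times> void A) \<inter> space (J \<Otimes>\<^sub>M coins p))"
      unfolding V_def using B sets_void[OF A] by (intro emeasure_distr[OF f]) simp
    also have "f -` (B \<times> void A) \<inter> space (J \<Otimes>\<^sub>M coins p) =
        {z \<in> space (J \<Otimes>\<^sub>M coins p). fst z \<in> ?D \<and> thin (snd (fst z)) (snd z) \<in> void A}"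
      by (auto simp: f_def space_pair_measure spJ)
    also have "emeasure (J \<Otimes>\<^sub>M coins p) \<dots> =
        (\<Sum>j. ennreal ((1 - p) ^ j) * emeasure J {w \<in> ?D. emeasure (snd w) A = of_nat j})"
      by (rule emeasure_thin_void[OF J(1) sndJ D A p])
    finally show ?thesis unfolding slice .
  qed
  have W: "emeasure W (void A) =
      (\<Sum>j. ennreal ((1 - q) ^ j) * emeasure P {\<xi>\<in>simple_counting_measures. emeasure \<xi> A = of_nat j})"
    if A: "A \<in> sets borel" for A
  proof -
    have "emeasure W (void A) = emeasure (P \<Otimes>\<^sub>M coins q) (g -` void A \<inter> space (P \<Otimes>\<^sub>M coins q))"
      unfolding W_def by (rule emeasure_distr[OF g sets_void[OF A]])
    also have "g -` void A \<inter> space (P \<Otimes>\<^sub>M coins q) =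
        {z \<in> space (P \<Otimes>\<^sub>M coins q). fst z \<in> simple_counting_measures \<and> thin (fst z) (snd z) \<in> void A}"
      by (auto simp: g_def space_pair_measure spP)
    also have "emeasure (P \<Otimes>\<^sub>M coins q) \<dots> =
        (\<Sum>j. ennreal ((1 - q) ^ j) * emeasure P {w \<in> simple_counting_measures. emeasure w A = of_nat j})"
      by (rule emeasure_thin_void[OF P(1) idP _ A q]) (use sets.top[of P] in \<open>simp add: spP\<close>)
    finally show ?thesis .
  qed
  have K: "emeasure (distr (V \<Otimes>\<^sub>M W) (N \<Otimes>\<^sub>M ?C) h) (B \<times> void A) = emeasure V (B \<times> void A) * emeasure W (void A)"
    if B: "B \<in> sets N" and A: "A \<in> sets borel" for B A
  proof -
    have BA: "B \<times> void A \<in> sets (N \<Otimes>\<^sub>M ?C)" using B sets_void[OF A] by simp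
    have spVW: "space V = space N \<times> simple_counting_measures" "space W = simple_counting_measures"
      using sets_eq_imp_space_eq[OF sets_VW(1)] sets_eq_imp_space_eq[OF sets_VW(2)] by (simp_all add: space_pair_measure)
    have "emeasure (distr (V \<Otimes>\<^sub>M W) (N \<Otimes>\<^sub>M ?C) h) (B \<times> void A) =
        emeasure (V \<Otimes>\<^sub>M W) (h -` (B \<times> void A) \<inter> space (V \<Otimes>\<^sub>M W))"
      by (rule emeasure_distr[OF h BA])
    also have "h -` (B \<times> void A) \<inter> space (V \<Otimes>\<^sub>M W) = (B \<times> void A) \<times> void A"
    proof -
      have "superpose \<xi> \<eta> \<in> void A \<longleftrightarrow> \<xi> \<in> void A \<and> \<eta> \<in> void A"
        if "\<xi> \<in> simple_counting_measures" "\<eta> \<in> simple_counting_measures" for \<xi> \<eta>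
        by (rule superpose_void_iff[OF that A])
      moreover have "\<xi> \<in> simple_counting_measures" if "\<xi> \<in> void A" for \<xi> using that by (simp add: void_def)
      moreover have "y \<in> space N" if "y \<in> B" for y using sets.sets_into_space[OF B] that by blast
      ultimately show ?thesis by (auto simp: h_def space_pair_measure spVW)
    qed
    also have "emeasure (V \<Otimes>\<^sub>M W) \<dots> = emeasure V (B \<times> void A) * emeasure W (void A)"
      using BA sets_void[OF A] by (intro W.emeasure_pair_measure_Times) auto
    finally show ?thesis .
  qed
  show thesis
  proof (rule that)
    show "prob_space (distr (V \<Otimes>\<^sub>M W) (N \<Otimes>\<^sub>M ?C) h)" by (rule VW.prob_space_distr[OF h])
  qed (use K V W in simp_all)
qed

theorem proposition5p7:
  fixes M :: "'x::polish_space measure" and T :: "'x \<Rightarrow> 'x"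
    and N :: "'y measure" and S :: "'y \<Rightarrow> 'y"
    and P P\<^sub>\<alpha> :: "'x measure measure" and \<alpha> :: real
  assumes "infinite_invertible_system M T" and "conservative M T" and "ergodic M T"
    and "property_P1 M T" and "property_P2 M T"
    and "measurable_law_of_large_numbers M T"
    and "probability_preserving_system N S"
    and "poisson_law M P"
    and "disjoint_systems N S P (suspension_map T)"
    and "\<alpha> > 0"
    and "poisson_law (scale_measure (ennreal \<alpha>) M) P\<^sub>\<alpha>"
  shows "disjoint_systems N S P\<^sub>\<alpha> (suspension_map T)"
  unfolding disjoint_systems_def
proof (intro allI impI)
  let ?C = "configuration_space :: 'x measure measure"
  let ?M\<alpha> = "scale_measure (ennreal \<alpha>) M"
  let ?n = "\<lambda>A (j::nat). {\<xi>\<in>simple_counting_measures. emeasure \<xi> A = of_nat j} :: 'x measure set"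
  fix J assume "joining N S P\<^sub>\<alpha> (suspension_map T) J"
  note J = joiningD[OF this]
  note P = assms(8) and P\<alpha> = assms(11) and \<alpha> = assms(10)
  note sP = poisson_lawD[OF P] and sP\<alpha> = poisson_lawD[OF P\<alpha>]
  have M: "sets M = sets borel" and bfM: "boundedly_finite M" and bij: "bij T"
    and TM: "T \<in> M \<rightarrow>\<^sub>M M" and invM: "invariant_measure M T"
    using assms(1) by (auto simp: infinite_invertible_system_def)
  have T: "T \<in> borel \<rightarrow>\<^sub>M borel" using TM by (simp add: measurable_cong_sets[OF M M])
  have spM: "space M = UNIV" using sets_eq_imp_space_eq[OF M] by simp
  have N: "prob_space N" and S: "S \<in> N \<rightarrow>\<^sub>M N"
    using assms(7) by (auto simp: probability_preserving_system_def)
  interpret N: prob_space N by fact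
  interpret J: prob_space J by (rule J(2))
  have finM: "emeasure M A < \<infinity>" if "A \<in> sets borel" "bounded A" for A
    using bfM that M by (auto simp: boundedly_finite_def)
  have finM': "emeasure ?M\<alpha> A < \<infinity>" if "emeasure M A < \<infinity>" for A
    using that by (simp add: emeasure_scale_measure ennreal_mult_less_top)
  have m\<alpha>: "measure ?M\<alpha> A = \<alpha> * measure M A" for A
    using \<alpha> by (simp add: measure_def emeasure_scale_measure enn2real_mult)
  have sets\<alpha>: "sets ?M\<alpha> = sets borel" by (simp add: M)
  have inv\<alpha>: "invariant_measure ?M\<alpha> T"
    using invM by (simp add: invariant_measure_def emeasure_scale_measure space_scale_measure)
  have bf\<alpha>: "boundedly_finite ?M\<alpha>"
    unfolding boundedly_finite_def using finM finM' sets\<alpha> by blast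
  have setsJ: "sets J = sets (N \<Otimes>\<^sub>M ?C)"
    using J(1) sets_pair_measure_cong[OF refl sP\<alpha>(1)] by simp
  have JF: "AE z in J. snd z \<in> finite_preimages T"
    by (rule AE_marginal_finite_preimages[OF T sets\<alpha> bf\<alpha> inv\<alpha> P\<alpha> setsJ J(5)])
  have J_snd: "emeasure J (space N \<times> V) = emeasure P\<^sub>\<alpha> V" if "V \<in> sets ?C" for V
  proof -
    have snd: "snd \<in> J \<rightarrow>\<^sub>M P\<^sub>\<alpha>"
      unfolding measurable_cong_sets[OF setsJ sP\<alpha>(1)] by (rule measurable_snd)
    have "emeasure P\<^sub>\<alpha> V = emeasure (distr J P\<^sub>\<alpha> snd) V" by (simp only: J(5))
    also have "\<dots> = emeasure J (snd -` V \<inter> space J)"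
      by (rule emeasure_distr[OF snd]) (simp add: that sP\<alpha>(1))
    also have "snd -` V \<inter> space J = space N \<times> V"
      using sets_eq_imp_space_eq[OF setsJ] sets.sets_into_space[OF that] by (auto simp: space_pair_measure)
    finally show ?thesis by simp
  qed
  have J_fst: "emeasure J (B \<times> simple_counting_measures) = emeasure N B" if "B \<in> sets N" for B
  proof -
    have fst: "fst \<in> J \<rightarrow>\<^sub>M N"
      unfolding measurable_cong_sets[OF setsJ refl] by (rule measurable_fst)
    have "emeasure N B = emeasure (distr J N fst) B" by (simp only: J(4))
    also have "\<dots> = emeasure J (fst -` B \<inter> space J)"
      by (rule emeasure_distr[OF fst that])
    also have "fst -` B \<inter> space J = B \<times> simple_counting_measures"
      using sets_eq_imp_space_eq[OF setsJ] sets.sets_into_space[OF that] by (auto simp: space_pair_measure)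
    finally show ?thesis by simp
  qed
  have n: "?n A j \<in> sets ?C" if [measurable]: "A \<in> sets borel" for A j
  proof -
    have "{\<xi>\<in>space ?C. emeasure \<xi> A = of_nat j} \<in> sets ?C" by measurable
    then show ?thesis by simp
  qed

  \<comment> \<open>Thinning \<open>P\<^sub>\<alpha>\<close> by \<open>p\<close> leaves intensity \<open>p\<alpha>\<mu>\<close>; the independent layer of intensity
    \<open>(1 - p\<alpha>)\<mu>\<close> restores intensity \<open>\<mu>\<close>, so that the hypothesis applies.\<close>
  have key: "(\<Sum>j. ennreal ((1 - p) ^ j) * emeasure J (B \<times> ?n A j)) = emeasure N B * ennreal (exp (- p * (\<alpha> * measure M A)))"
    if p: "0 < p" "p < 1" "p * \<alpha> < 1" and B: "B \<in> sets N" and A: "A \<in> sets borel" "bounded A" for p B A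
  proof -
    define q where "q = 1 - p * \<alpha>"
    have q: "0 < q" "q \<le> 1" using p \<alpha> by (auto simp: q_def)
    obtain K where K: "prob_space K" "sets K = sets (N \<Otimes>\<^sub>M ?C)"
      and eK: "\<And>B A. B \<in> sets N \<Longrightarrow> A \<in> sets borel \<Longrightarrow> emeasure K (B \<times> void A) =
        (\<Sum>j. ennreal ((1 - p) ^ j) * emeasure J (B \<times> ?n A j)) * (\<Sum>j. ennreal ((1 - q) ^ j) * emeasure P (?n A j))"
      by (rule thin_and_superpose[OF J(2) setsJ sP(2,1) p(1) less_imp_le[OF p(2)] q]) (rule that)
    have Kq: "emeasure K (B \<times> void A) =
        (\<Sum>j. ennreal ((1 - p) ^ j) * emeasure J (B \<times> ?n A j)) * ennreal (exp (- q * measure M A))"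
      if "B \<in> sets N" "A \<in> sets borel" "emeasure M A < \<infinity>" for B A
      using eK[OF that(1,2)] poisson_generating_function[OF P _ that(3), of "1 - q"] q that M by simp
    have spK: "space K = space N \<times> simple_counting_measures"
      using sets_eq_imp_space_eq[OF K(2)] by (simp add: space_pair_measure)
    interpret K: prob_space K by fact
    have fstK: "fst \<in> K \<rightarrow>\<^sub>M N"
      unfolding measurable_cong_sets[OF K(2) refl] by (rule measurable_fst)
    have sndK: "snd \<in> K \<rightarrow>\<^sub>M P"
      unfolding measurable_cong_sets[OF K(2) sP(1)] by (rule measurable_snd)
    have K1: "distr K N fst = N"
    proof (rule measure_eqI)
      fix B assume "B \<in> sets (distr K N fst)"
      then have B: "B \<in> sets N" by simp
      have 0: "?n {} j = (if j = 0 then simple_counting_measures else {})" for j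
        by auto
      have "emeasure (distr K N fst) B = emeasure K (fst -` B \<inter> space K)"
        by (rule emeasure_distr[OF fstK B])
      also have "fst -` B \<inter> space K = B \<times> void {}"
        using sets.sets_into_space[OF B] by (auto simp: spK)
      also have "emeasure K \<dots> = (\<Sum>j. ennreal ((1 - p) ^ j) * emeasure J (B \<times> ?n {} j))"
        using Kq[OF B, of "{}"] by simp
      also have "\<dots> = (\<Sum>j\<in>{0}. ennreal ((1 - p) ^ j) * emeasure J (B \<times> ?n {} j))"
        by (rule suminf_finite) (auto simp: 0)
      also have "\<dots> = emeasure N B" by (simp add: J_fst[OF B])
      finally show "emeasure (distr K N fst) B = emeasure N B" .
    qed simp
    have K2: "distr K P snd = P"
    proof (rule void_determines)
      show "prob_space (distr K P snd)" by (rule K.prob_space_distr[OF sndK])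
      fix A :: "'x set" assume A: "A \<in> sets borel" "bounded A"
      have AM: "A \<in> sets M" "A \<in> sets ?M\<alpha>" using A M by auto
      have "emeasure (distr K P snd) (void A) = emeasure K (snd -` void A \<inter> space K)"
        by (rule emeasure_distr[OF sndK]) (simp add: sets_void[OF A(1)] sP(1))
      also have "snd -` void A \<inter> space K = space N \<times> void A" by (auto simp: spK void_def)
      also have "emeasure K \<dots> = (\<Sum>j. ennreal ((1 - p) ^ j) * emeasure P\<^sub>\<alpha> (?n A j)) * ennreal (exp (- q * measure M A))"
        by (subst Kq[OF sets.top A(1) finM[OF A]]) (simp add: J_snd n[OF A(1)])
      also have "\<dots> = ennreal (exp (- p * (\<alpha> * measure M A))) * ennreal (exp (- q * measure M A))"
        using poisson_generating_function[OF P\<alpha> AM(2) finM'[OF finM[OF A]], of "1 - p"] p by (simp add: m\<alpha>)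
      also have "\<dots> = ennreal (exp (- p * (\<alpha> * measure M A)) * exp (- q * measure M A))"
        by (simp add: ennreal_mult)
      also have "exp (- p * (\<alpha> * measure M A)) * exp (- q * measure M A) = exp (- measure M A)"
        by (simp add: exp_add[symmetric] q_def algebra_simps)
      also have "ennreal \<dots> = emeasure P (void A)"
        by (rule poisson_void[OF P AM(1) finM[OF A], symmetric])
      finally show "emeasure (distr K P snd) (void A) = emeasure P (void A)" .
    qed (simp_all add: sP(1))
    have "invariant_measure K (map_prod S (suspension_map T))"
    proof (rule invariant_suspensionI[OF K S bij T])
      show "AE z in K. snd z \<in> finite_preimages T"
        by (rule AE_marginal_finite_preimages[OF T M bfM invM P K(2) K2])
      fix B and A :: "'x set" assume B: "B \<in> sets N" and A: "A \<in> sets borel" "bounded A"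
      have TA: "emeasure M (T -` A) = emeasure M A"
        using invM A M by (simp add: invariant_measure_def spM)
      have "emeasure J ((S -` B \<inter> space N) \<times> ?n (T -` A) j) = emeasure J (B \<times> ?n A j)" for j
        by (rule invariant_suspension_count[OF J(2) setsJ bij T S JF J(3) B A(1)])
      then show "emeasure K ((S -` B \<inter> space N) \<times> void (T -` A)) = emeasure K (B \<times> void A)"
        using Kq[OF measurable_sets[OF S B] measurable_vimage[OF T A(1)]] Kq[OF B A(1) finM[OF A]] finM[OF A]
        by (simp add: TA measure_def)
    qed
    moreover have "sets K = sets (N \<Otimes>\<^sub>M P)"
      by (rule trans[OF K(2) sets_pair_measure_cong[OF refl sP(1)[symmetric]]])
    ultimately have "joining N S P (suspension_map T) K"
      using K K1 K2 by (simp add: joining_def)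
    then have KNP: "K = N \<Otimes>\<^sub>M P" using assms(9) by (simp add: disjoint_systems_def)
    interpret P: prob_space P by (rule sP(2))
    have e: "ennreal (exp (- measure M A)) =
        ennreal (exp (- p * (\<alpha> * measure M A))) * ennreal (exp (- q * measure M A))"
      by (simp add: ennreal_mult[symmetric] exp_add[symmetric] q_def algebra_simps)
    have "(\<Sum>j. ennreal ((1 - p) ^ j) * emeasure J (B \<times> ?n A j)) * ennreal (exp (- q * measure M A)) =
        emeasure K (B \<times> void A)"
      by (rule Kq[OF B A(1) finM[OF A], symmetric])
    also have "\<dots> = emeasure N B * emeasure P (void A)"
      unfolding KNP using B sets_void[OF A(1)] by (intro P.emeasure_pair_measure_Times) (auto simp: sP(1))
    also have "\<dots> = emeasure N B * ennreal (exp (- p * (\<alpha> * measure M A))) * ennreal (exp (- q * measure M A))"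
      using poisson_void[OF P _ finM[OF A]] A M by (simp add: e mult.assoc)
    finally show ?thesis
      by (simp add: mult_right_ennreal_cancel)
  qed

  show "J = N \<Otimes>\<^sub>M P\<^sub>\<alpha>"
  proof (rule void_rectangles_determine[OF setsJ J(2)])
    show "sets (N \<Otimes>\<^sub>M P\<^sub>\<alpha>) = sets (N \<Otimes>\<^sub>M ?C)"
      by (rule sets_pair_measure_cong[OF refl sP\<alpha>(1)])
    fix B and A :: "'x set" assume B: "B \<in> sets N" and A: "A \<in> sets borel" "bounded A"
    interpret P\<alpha>: prob_space P\<^sub>\<alpha> by (rule sP\<alpha>(2))
    let ?m = "\<alpha> * measure M A"
    define a where "a j = measure J (B \<times> ?n A j)" for j
    define b where "b j = measure N B * exp (- ?m) * (?m ^ j / fact j)" for j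
    have m0: "0 \<le> ?m" using \<alpha> by simp
    have BA: "B \<times> ?n A j \<in> sets J" for j using B n[OF A(1)] by (simp add: setsJ)
    have sa: "summable a"
      unfolding a_def by (rule sums_summable[OF J.finite_measure_UNION])
        (use BA in \<open>auto simp: disjoint_family_on_def\<close>)
    have b_sums: "(\<lambda>j. b j * z ^ j) sums (measure N B * exp (- ?m) * exp (?m * z))" for z
    proof -
      have "(\<lambda>j. measure N B * exp (- ?m) * ((?m * z) ^ j /\<^sub>R fact j)) sums (measure N B * exp (- ?m) * exp (?m * z))"
        by (intro sums_mult exp_converges)
      then show ?thesis by (simp add: b_def power_mult_distrib field_simps)
    qed
    have sb: "summable b" using sums_summable[OF b_sums[of 1]] by simp
    have pos: "0 \<le> a j" "0 \<le> b j" for j using m0 by (auto simp: a_def b_def)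
    \<comment> \<open>With \<open>z = 1 - p\<close>, the constraints \<open>0 < p < 1\<close> and \<open>p\<alpha> < 1\<close> say that \<open>z\<close> lies between
      this bound and \<open>1\<close>.\<close>
    let ?r = "max 0 (1 - 1 / \<alpha>)"
    have "a 0 = b 0"
    proof (rule power_series_interval_eq[where r="?r"])
      show "?r < 1" using \<alpha> by simp
      fix z assume z: "?r < z" "z < 1"
      then have p: "0 < 1 - z" "1 - z < 1" "(1 - z) * \<alpha> < 1"
        using \<alpha> by (auto simp: field_simps)
      have "(\<Sum>j. ennreal (a j * z ^ j)) = (\<Sum>j. ennreal ((1 - (1 - z)) ^ j) * emeasure J (B \<times> ?n A j))"
        using z by (intro suminf_cong) (simp add: a_def J.emeasure_eq_measure ennreal_mult[symmetric] mult.commute)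
      also have "\<dots> = ennreal (measure N B * exp (- (1 - z) * ?m))"
        using key[OF p B A] by (simp add: N.emeasure_eq_measure ennreal_mult)
      also have "measure N B * exp (- (1 - z) * ?m) = measure N B * exp (- ?m) * exp (?m * z)"
        by (simp add: exp_add[symmetric] algebra_simps)
      finally have e: "(\<Sum>j. ennreal (a j * z ^ j)) = ennreal (measure N B * exp (- ?m) * exp (?m * z))" .
      have "summable (\<lambda>j. a j * z ^ j)"
        by (rule summable_comparison_test'[OF sa, of 0])
          (use z pos(1) in \<open>auto simp: abs_mult power_abs intro!: mult_left_le power_le_one\<close>)
      then have "ennreal (\<Sum>j. a j * z ^ j) = (\<Sum>j. ennreal (a j * z ^ j))"
        using z pos(1) by (intro suminf_ennreal2[symmetric]) auto
      then have "(\<Sum>j. a j * z ^ j) = measure N B * exp (- ?m) * exp (?m * z)"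
        unfolding e using z pos(1) \<open>summable (\<lambda>j. a j * z ^ j)\<close>
        by (subst (asm) ennreal_inj) (auto intro!: suminf_nonneg)
      also have "\<dots> = (\<Sum>j. b j * z ^ j)" by (rule sums_unique[OF b_sums])
      finally show "(\<Sum>j. a j * z ^ j) = (\<Sum>j. b j * z ^ j)" .
    qed (use sa sb pos in simp_all)
    then have "measure J (B \<times> void A) = measure N B * exp (- ?m)"
      by (simp add: a_def b_def void_def)
    then have "emeasure J (B \<times> void A) = emeasure N B * ennreal (exp (- ?m))"
      by (simp add: J.emeasure_eq_measure N.emeasure_eq_measure ennreal_mult)
    also have "ennreal (exp (- ?m)) = emeasure P\<^sub>\<alpha> (void A)"
      using poisson_void[OF P\<alpha> _ finM'[OF finM[OF A]]] A M by (simp add: m\<alpha>)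
    also have "emeasure N B * \<dots> = emeasure (N \<Otimes>\<^sub>M P\<^sub>\<alpha>) (B \<times> void A)"
      using B sets_void[OF A(1)] by (intro P\<alpha>.emeasure_pair_measure_Times[symmetric]) (auto simp: sP\<alpha>(1))
    finally show "emeasure J (B \<times> void A) = emeasure (N \<Otimes>\<^sub>M P\<^sub>\<alpha>) (B \<times> void A)" .
  qed
qed

end
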